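(* Let $\mathbb{K}$ be an algebraically closed field, let $q\in\mathbb{K}^*$ be such that $q^2$ is a primitive $l$-th root of unity with $l>1$, and let $\alpha,\gamma\in\mathbb{K}$ with $\gamma\neq0$. Then each simple $A(\alpha,0,\gamma)$-module on which $z$ acts nilpotently is isomorphic to the simple $A(\alpha,0,\gamma)$-module $M_5(\mu_1,\mu_2)$ for some $(\mu_1,\mu_2)\in\mathbb{K}^2$.
   Context: For $\alpha,\gamma\in\mathbb{K}$ and $q\in\mathbb{K}^*$, $A(\alpha,0,\gamma)$ is the associative unital $\mathbb{K}$-algebra generated by $x,y,z$ subject to $xy=q^2yx+\alpha$, $xz=q^{-2}zx$, $yz=q^2zy+\gamma$. Modules are right modules (so in $m\,xy$ the element $x$ acts first). $M_5(\mu_1,\mu_2)$, for $(\mu_1,\mu_2)\in\mathbb{K}^2$ (and $\gamma\neq0$): the $\mathbb{K}$-vector space with basis $m_k$, $0\le k\le l-1$, with $$m_kx=\mu_2\gamma^{-1}q^{-2k}(q^2-1)m_k-q^{-2}\alpha\tfrac{1-q^{-2k}}{1-q^{-2}}m_{k-1}\ (k\neq0),\qquad m_0x=\mu_2\gamma^{-1}(q^2-1)m_0,$$ $$m_ky=m_{k+1}\ (k\neq l-1),\qquad m_{l-1}y=\mu_1m_0,$$ $$m_kz=\gamma\tfrac{1-q^{2k}}{1-q^2}m_{k-1}\ (k\neq0),\qquad m_0z=0.$$ *)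

theory Defs
  imports
    "HOL-Algebra.QuotRing"
    "HOL-Library.Poly_Mapping"
    "HOL-Computational_Algebra.Polynomial"
begin

section \<open>The algebra \<open>A(\<alpha>, 0, \<gamma>)\<close>\<close>

datatype gen = Gx | Gy | Gz

text \<open>
  The free monoid on the three generators. It is a separate type because the convolution
  product on \<^typ>\<open>'a \<Rightarrow>\<^sub>0 'k\<close> needs the class \<^class>\<open>monoid_add\<close> on \<open>'a\<close>:
  concatenation of words is written additively.
\<close>
datatype word = Word (letters: "gen list")

instantiation word :: monoid_add
begin

definition zero_word :: word
  where "0 = Word []"

definition plus_word :: "word \<Rightarrow> word \<Rightarrow> word"
  where "u + v = Word (letters u @ letters v)"

instance
  by standard (simp_all add: zero_word_def plus_word_def)

end

text \<open>
  The free unital associative algebra on \<open>x, y, z\<close> is the monoid algebra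
  \<^typ>\<open>word \<Rightarrow>\<^sub>0 'k\<close>, as a ring record so that the quotient construction of
  HOL-Algebra applies.
\<close>
definition free_algebra :: "(word \<Rightarrow>\<^sub>0 'k::field) ring"
  where "free_algebra = \<lparr>carrier = UNIV, monoid.mult = (*), one = 1, zero = 0, add = (+)\<rparr>"

definition fgen :: "gen \<Rightarrow> (word \<Rightarrow>\<^sub>0 'k::field)"
  where "fgen g = Poly_Mapping.single (Word [g]) 1"

definition fscal :: "'k::field \<Rightarrow> (word \<Rightarrow>\<^sub>0 'k)"
  where "fscal c = Poly_Mapping.single 0 c"

definition A_relations :: "'k::field \<Rightarrow> 'k \<Rightarrow> 'k \<Rightarrow> (word \<Rightarrow>\<^sub>0 'k) set"
  where "A_relations q \<alpha> \<gamma> =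
    {fgen Gx * fgen Gy - (fscal (q ^ 2) * fgen Gy * fgen Gx + fscal \<alpha>),
     fgen Gx * fgen Gz - fscal (q powi (-2)) * fgen Gz * fgen Gx,
     fgen Gy * fgen Gz - (fscal (q ^ 2) * fgen Gz * fgen Gy + fscal \<gamma>)}"

definition A_ideal :: "'k::field \<Rightarrow> 'k \<Rightarrow> 'k \<Rightarrow> (word \<Rightarrow>\<^sub>0 'k) set"
  where "A_ideal q \<alpha> \<gamma> = genideal free_algebra (A_relations q \<alpha> \<gamma>)"

definition A_algebra :: "'k::field \<Rightarrow> 'k \<Rightarrow> 'k \<Rightarrow> (word \<Rightarrow>\<^sub>0 'k) set ring"
  where "A_algebra q \<alpha> \<gamma> = free_algebra Quot (A_ideal q \<alpha> \<gamma>)"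

definition A_gen :: "'k::field \<Rightarrow> 'k \<Rightarrow> 'k \<Rightarrow> gen \<Rightarrow> (word \<Rightarrow>\<^sub>0 'k) set"
  where "A_gen q \<alpha> \<gamma> g = A_ideal q \<alpha> \<gamma> +>\<^bsub>free_algebra\<^esub> fgen g"


section \<open>Right modules\<close>

text \<open>
  HOL-Algebra only has modules over commutative rings. As in its record \<open>module\<close>,
  the fields \<^const>\<open>monoid.mult\<close> and \<^const>\<open>one\<close> inherited from \<^typ>\<open>'b ring\<close> carry no information.
  Over a \<open>K\<close>-algebra with unit the vector space structure of a module is the restriction of
  the action to the scalars, so it is not a separate datum, and module homomorphisms are
  automatically \<open>K\<close>-linear.
\<close>
record ('a, 'm) right_module = "'m ring" +
  ract :: "'m \<Rightarrow> 'a \<Rightarrow> 'm"  (infixl "\<triangleleft>\<index>" 70)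

locale right_module = R?: ring R + M?: abelian_group M
  for R :: "('a, 'c) ring_scheme" and M :: "('a, 'm, 'd) right_module_scheme" (structure) +
  assumes ract_closed: "\<lbrakk>m \<in> carrier M; a \<in> carrier R\<rbrakk> \<Longrightarrow> m \<triangleleft> a \<in> carrier M"
    and ract_add_left: "\<lbrakk>m \<in> carrier M; n \<in> carrier M; a \<in> carrier R\<rbrakk>
      \<Longrightarrow> (m \<oplus> n) \<triangleleft> a = m \<triangleleft> a \<oplus> n \<triangleleft> a"
    and ract_add_right: "\<lbrakk>m \<in> carrier M; a \<in> carrier R; b \<in> carrier R\<rbrakk>
      \<Longrightarrow> m \<triangleleft> (a \<oplus>\<^bsub>R\<^esub> b) = m \<triangleleft> a \<oplus> m \<triangleleft> b"
    and ract_mult: "\<lbrakk>m \<in> carrier M; a \<in> carrier R; b \<in> carrier R\<rbrakk>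
      \<Longrightarrow> m \<triangleleft> (a \<otimes>\<^bsub>R\<^esub> b) = (m \<triangleleft> a) \<triangleleft> b"
    and ract_one: "m \<in> carrier M \<Longrightarrow> m \<triangleleft> \<one>\<^bsub>R\<^esub> = m"

definition right_submodule ::
  "'m set \<Rightarrow> ('a, 'c) ring_scheme \<Rightarrow> ('a, 'm, 'd) right_module_scheme \<Rightarrow> bool"
  where "right_submodule N R M \<longleftrightarrow>
    subgroup N (add_monoid M) \<and> (\<forall>n\<in>N. \<forall>a\<in>carrier R. n \<triangleleft>\<^bsub>M\<^esub> a \<in> N)"

definition simple_right_module ::
  "('a, 'c) ring_scheme \<Rightarrow> ('a, 'm, 'd) right_module_scheme \<Rightarrow> bool"
  where "simple_right_module R M \<longleftrightarrow>
    right_module R M \<and> carrier M \<noteq> {\<zero>\<^bsub>M\<^esub>} \<and>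
    (\<forall>N. right_submodule N R M \<longrightarrow> N = {\<zero>\<^bsub>M\<^esub>} \<or> N = carrier M)"

definition right_module_isomorphic ::
  "('a, 'c) ring_scheme \<Rightarrow> ('a, 'm, 'd) right_module_scheme \<Rightarrow>
    ('a, 'n, 'e) right_module_scheme \<Rightarrow> bool"
  where "right_module_isomorphic R M N \<longleftrightarrow>
    (\<exists>f. bij_betw f (carrier M) (carrier N) \<and>
      (\<forall>m\<in>carrier M. \<forall>m'\<in>carrier M. f (m \<oplus>\<^bsub>M\<^esub> m') = f m \<oplus>\<^bsub>N\<^esub> f m') \<and>
      (\<forall>m\<in>carrier M. \<forall>a\<in>carrier R. f (m \<triangleleft>\<^bsub>M\<^esub> a) = f m \<triangleleft>\<^bsub>N\<^esub> a))"

definition acts_nilpotently ::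
  "('a, 'c) ring_scheme \<Rightarrow> ('a, 'm, 'd) right_module_scheme \<Rightarrow> 'a \<Rightarrow> bool"
  where "acts_nilpotently R M a \<longleftrightarrow>
    (\<exists>n::nat. \<forall>m\<in>carrier M. m \<triangleleft>\<^bsub>M\<^esub> (a [^]\<^bsub>R\<^esub> n) = \<zero>\<^bsub>M\<^esub>)"


section \<open>The modules \<open>M\<^sub>5(\<mu>\<^sub>1, \<mu>\<^sub>2)\<close>\<close>

definition primitive_root_of_unity :: "nat \<Rightarrow> 'k::field \<Rightarrow> bool"
  where "primitive_root_of_unity l u \<longleftrightarrow>
    0 < l \<and> u ^ l = 1 \<and> (\<forall>j. 0 < j \<and> j < l \<longrightarrow> u ^ j \<noteq> 1)"

text \<open>
  The space with basis \<open>m\<^sub>0, \<dots>, m\<^bsub>l-1\<^esub>\<close> is the space of functions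
  \<^typ>\<open>nat \<Rightarrow> 'k\<close> vanishing outside \<open>{..<l}\<close>.
\<close>
definition M5_basis :: "nat \<Rightarrow> (nat \<Rightarrow> 'k::field)"
  where "M5_basis k = (\<lambda>j. if j = k then 1 else 0)"

fun M5_on_basis ::
  "'k::field \<Rightarrow> 'k \<Rightarrow> 'k \<Rightarrow> nat \<Rightarrow> 'k \<Rightarrow> 'k \<Rightarrow> gen \<Rightarrow> nat \<Rightarrow> (nat \<Rightarrow> 'k)"
  where
    "M5_on_basis q \<alpha> \<gamma> l \<mu>1 \<mu>2 Gx k =
      (if k = 0 then (\<lambda>j. \<mu>2 * inverse \<gamma> * (q ^ 2 - 1) * M5_basis 0 j)
       else (\<lambda>j. \<mu>2 * inverse \<gamma> * q powi (- 2 * int k) * (q ^ 2 - 1) * M5_basis k j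
         - q powi (-2) * \<alpha> * ((1 - q powi (- 2 * int k)) / (1 - q powi (-2)))
           * M5_basis (k - 1) j))"
  | "M5_on_basis q \<alpha> \<gamma> l \<mu>1 \<mu>2 Gy k =
      (if k = l - 1 then (\<lambda>j. \<mu>1 * M5_basis 0 j) else M5_basis (k + 1))"
  | "M5_on_basis q \<alpha> \<gamma> l \<mu>1 \<mu>2 Gz k =
      (if k = 0 then (\<lambda>j. 0)
       else (\<lambda>j. \<gamma> * ((1 - q ^ (2 * k)) / (1 - q ^ 2)) * M5_basis (k - 1) j))"

definition M5_gen_act ::
  "'k::field \<Rightarrow> 'k \<Rightarrow> 'k \<Rightarrow> nat \<Rightarrow> 'k \<Rightarrow> 'k \<Rightarrow> (nat \<Rightarrow> 'k) \<Rightarrow> gen \<Rightarrow> (nat \<Rightarrow> 'k)"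
  where "M5_gen_act q \<alpha> \<gamma> l \<mu>1 \<mu>2 v g =
    (\<lambda>j. \<Sum>k<l. v k * M5_on_basis q \<alpha> \<gamma> l \<mu>1 \<mu>2 g k j)"

text \<open>Right action: the leftmost letter of a word acts first, whence \<^const>\<open>foldl\<close>.\<close>
definition M5_free_act ::
  "'k::field \<Rightarrow> 'k \<Rightarrow> 'k \<Rightarrow> nat \<Rightarrow> 'k \<Rightarrow> 'k \<Rightarrow> (nat \<Rightarrow> 'k) \<Rightarrow> (word \<Rightarrow>\<^sub>0 'k) \<Rightarrow> (nat \<Rightarrow> 'k)"
  where "M5_free_act q \<alpha> \<gamma> l \<mu>1 \<mu>2 v p =
    (\<lambda>j. \<Sum>w\<in>Poly_Mapping.keys p.
      Poly_Mapping.lookup p w * foldl (M5_gen_act q \<alpha> \<gamma> l \<mu>1 \<mu>2) v (letters w) j)"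

text \<open>
  An element of the quotient algebra is a coset; it acts as any of its representatives.
  Independence of the representative (for \<open>q\<^sup>2\<close> a primitive \<open>l\<close>-th root of unity, \<open>l > 1\<close> and
  \<open>\<gamma> \<noteq> 0\<close>) is part of the assertion that this is a module over \<^const>\<open>A_algebra\<close>.
\<close>
definition M5 ::
  "'k::field \<Rightarrow> 'k \<Rightarrow> 'k \<Rightarrow> nat \<Rightarrow> 'k \<Rightarrow> 'k \<Rightarrow> ((word \<Rightarrow>\<^sub>0 'k) set, nat \<Rightarrow> 'k) right_module"
  where "M5 q \<alpha> \<gamma> l \<mu>1 \<mu>2 =
    \<lparr>carrier = {v. \<forall>k\<ge>l. v k = 0}, monoid.mult = undefined, one = undefined,
     zero = (\<lambda>_. 0), add = (\<lambda>v w k. v k + w k),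
     ract = (\<lambda>v S. the_elem (M5_free_act q \<alpha> \<gamma> l \<mu>1 \<mu>2 v ` S))\<rparr>"

end

theory Submission
  imports Defs
begin

text \<open>
  Choose \<open>m \<noteq> 0\<close> with \<open>mz = 0\<close>. Modulo \<open>z\<close> on the left, every element of \<open>A\<close> is a combination
  \<open>\<Sum>\<^bsub>j<l\<^esub> f\<^sub>j(x, y\<^sup>l) y\<^sup>j\<close>, where \<open>x\<close> and \<open>y\<^sup>l\<close> commute, and right multiplication by \<open>z\<close>
  separates the summands \<open>m f\<^sub>j(x, y\<^sup>l) y\<^sup>j\<close>. Hence the polynomials in \<open>x\<close> and \<open>y\<^sup>l\<close> that
  annihilate \<open>m\<close> form a maximal ideal of \<open>K[X, Y]\<close>, and by the Nullstellensatz \<open>m\<close> is a common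
  eigenvector of \<open>x\<close> and \<open>y\<^sup>l\<close>. The two eigenvalues determine the annihilator of \<open>m\<close>, which is
  therefore that of the basis vector \<open>m\<^sub>0\<close> of a suitable \<open>M\<^sub>5(\<mu>\<^sub>1, \<mu>\<^sub>2)\<close>.
\<close>

section \<open>One-sided ideals and evaluation of polynomials in noncommutative rings\<close>

text \<open>Neither a finite dimension of the module nor an uncountable field is assumed, so
  characteristic polynomials and cardinality arguments do not yield the eigenvector. Simplicity is
  used as invertibility modulo the annihilator of a vector, and the inverse it supplies is an
  arbitrary element \<open>a\<close> of the algebra. Separating the powers of \<open>y\<close> turns
  it into a polynomial: if \<open>m f a = m\<close>, the summand of exponent 0 of
  \<open>m f a\<close> is \<open>m f g\<close> with a polynomial \<open>g\<close>, and comparison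
  with \<open>m\<close> gives \<open>m f g = m\<close>. Both uses of \<open>l\<close> come from one
  formula: with \<open>t = q ^ 2\<close>, moving \<open>z\<close> past \<open>y ^ j\<close> leaves
  the scalar \<gamma> times \<open>1 + t + ... + t ^ (j - 1)\<close>. It is nonzero for
  \<open>0 < j < l\<close>, which separates the summands, and zero for \<open>j = l\<close>, which
  lets \<open>y ^ l\<close> commute with \<open>z\<close>; the same happens for \<open>x\<close>.
  The computation takes place in the free algebra, by congruences modulo right ideals that contain
  the relations; a module enters through the annihilator of a vector. Two proper right ideals
  containing \<open>z\<close>, \<open>x - a\<close> and \<open>y ^ l - b\<close> are compared
  directly, without a dimension count.\<close>

locale right_ideal =
  fixes J :: "'a::ring_1 set"
  assumes zero_mem: "0 \<in> J"
    and diff_mem: "\<lbrakk>a \<in> J; b \<in> J\<rbrakk> \<Longrightarrow> a - b \<in> J"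
    and rmult_mem: "a \<in> J \<Longrightarrow> a * b \<in> J"
begin

lemma uminus_mem: "a \<in> J \<Longrightarrow> - a \<in> J"
  using diff_mem[OF zero_mem] by simp

lemma add_mem: "\<lbrakk>a \<in> J; b \<in> J\<rbrakk> \<Longrightarrow> a + b \<in> J"
  using diff_mem[OF _ uminus_mem] by fastforce

lemma sum_mem: "(\<And>i. i \<in> A \<Longrightarrow> f i \<in> J) \<Longrightarrow> sum f A \<in> J"
  by (induction A rule: infinite_finite_induct) (simp_all add: zero_mem add_mem)

lemma diff_swap: "a - b \<in> J \<Longrightarrow> b - a \<in> J"
  using uminus_mem by fastforce

lemma diff_trans: "\<lbrakk>a - b \<in> J; b - c \<in> J\<rbrakk> \<Longrightarrow> a - c \<in> J"
  using add_mem by fastforce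

lemma diff_add: "\<lbrakk>a - b \<in> J; c - d \<in> J\<rbrakk> \<Longrightarrow> (a + c) - (b + d) \<in> J"
  using add_mem[of "a - b" "c - d"] by (simp add: algebra_simps)

lemma diff_rmult: "a - b \<in> J \<Longrightarrow> a * c - b * c \<in> J"
  using rmult_mem by (metis left_diff_distrib)

lemma diff_mem_iff: "a - b \<in> J \<Longrightarrow> a \<in> J \<longleftrightarrow> b \<in> J"
  using add_mem[of "a - b" b] diff_mem[of a "a - b"] by auto

end

locale two_sided_ideal = right_ideal +
  assumes lmult_mem: "a \<in> J \<Longrightarrow> b * a \<in> J"

lemma right_ideal_Int: "\<lbrakk>right_ideal J; right_ideal J'\<rbrakk> \<Longrightarrow> right_ideal (J \<inter> J')"
  by (simp add: right_ideal_def)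

text \<open>\<open>h\<close> is an arbitrary map because evaluation is used in two layers: first
  \<open>s\<close> at \<open>x\<close>, then the resulting map, multiplicative only modulo
  \<open>I\<close>, at \<open>y ^ l\<close>. Powers of \<open>t\<close> stand on the right, so a
  Horner step is a right multiplication.\<close>

definition ev :: "('b::zero \<Rightarrow> 'a::ring_1) \<Rightarrow> 'a \<Rightarrow> 'b poly \<Rightarrow> 'a"
  where "ev h t p = (\<Sum>i\<le>degree p. h (coeff p i) * t ^ i)"

locale evaluation =
  fixes h :: "'b::comm_ring_1 \<Rightarrow> 'a::ring_1" and t :: 'a
  assumes h_0: "h 0 = 0" and h_add: "h (a + b) = h a + h b"
begin

lemma ev_eq_sum: "degree p \<le> n \<Longrightarrow> ev h t p = (\<Sum>i\<le>n. h (coeff p i) * t ^ i)"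
  unfolding ev_def by (rule sum.mono_neutral_left) (auto simp: h_0 coeff_eq_0)

lemma ev_0: "ev h t 0 = 0"
  by (simp add: ev_def h_0)

lemma ev_pCons: "ev h t (pCons a p) = h a + ev h t p * t"
proof -
  have "ev h t (pCons a p) = (\<Sum>i\<le>Suc (degree p). h (coeff (pCons a p) i) * t ^ i)"
    by (intro ev_eq_sum degree_pCons_le)
  also have "\<dots> = h a + (\<Sum>i\<le>degree p. h (coeff p i) * t ^ i * t)"
    by (subst sum.atMost_Suc_shift) (simp add: mult.assoc power_commutes)
  finally show ?thesis
    by (simp add: ev_def sum_distrib_right)
qed

lemma ev_const: "ev h t [:a:] = h a"
  by (simp add: ev_pCons ev_0)

lemma ev_add: "ev h t (p + p') = ev h t p + ev h t p'"
  by (induction p p' rule: poly_induct2) (simp_all add: ev_0 ev_pCons h_add algebra_simps)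

lemma ev_diff: "ev h t (p - p') = ev h t p - ev h t p'"
  by (metis ev_add add_diff_cancel_right' diff_add_cancel)

text \<open>Used with \<open>Z = {u. u * z \<in> J}\<close> to show that the values of polynomials
  stay in the kernel of \<open>z\<close>.\<close>

lemma ev_closed:
  assumes "0 \<in> Z" and "\<And>a b. \<lbrakk>a \<in> Z; b \<in> Z\<rbrakk> \<Longrightarrow> a + b \<in> Z"
    and "\<And>a. a \<in> Z \<Longrightarrow> a * t \<in> Z" and "\<And>a. h a \<in> Z"
  shows "ev h t p \<in> Z"
  by (induction p) (simp_all add: ev_0 ev_pCons assms)

lemma ev_commute:
  assumes "two_sided_ideal I" and "\<And>a. h a * w - w * h a \<in> I" and "t * w - w * t \<in> I"
  shows "ev h t p * w - w * ev h t p \<in> I"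
proof (induction p)
  case 0
  then show ?case
    using assms by (simp add: ev_0 two_sided_ideal_def right_ideal_def)
next
  case (pCons a p)
  interpret two_sided_ideal I by fact
  have "ev h t p * t * w - w * (ev h t p * t) = ev h t p * (t * w - w * t)
      + (ev h t p * w - w * ev h t p) * t"
    by (simp add: algebra_simps)
  then have "ev h t p * t * w - w * (ev h t p * t) \<in> I"
    by (simp add: add_mem lmult_mem rmult_mem assms(3) pCons.IH)
  then have "(h a * w - w * h a) + (ev h t p * t * w - w * (ev h t p * t)) \<in> I"
    by (intro add_mem assms(2))
  then show ?case
    by (simp add: ev_pCons algebra_simps)
qed

text \<open>The Horner step moves the value of \<open>p'\<close> past \<open>t\<close>, which
  \<open>ev_commute\<close> permits only modulo \<open>I\<close>; hence a congruence instead of an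
  equation.\<close>

lemma ev_mult:
  assumes "two_sided_ideal I" and h_mult: "\<And>a b. h (a * b) - h a * h b \<in> I"
    and comm: "\<And>a. h a * t - t * h a \<in> I"
  shows "ev h t (p * p') - ev h t p * ev h t p' \<in> I"
proof -
  interpret two_sided_ideal I by fact
  have smult: "ev h t (smult a p) - h a * ev h t p \<in> I" for a p
  proof (induction p)
    case (pCons b p)
    have "(h (a * b) - h a * h b) + (ev h t (smult a p) - h a * ev h t p) * t \<in> I"
      by (intro add_mem rmult_mem pCons.IH h_mult)
    then show ?case
      by (simp add: ev_pCons algebra_simps)
  qed (simp add: ev_0 zero_mem)
  show ?thesis
  proof (induction p)
    case (pCons a p)
    have "ev h t p' * t - t * ev h t p' \<in> I"
      by (rule ev_commute) (simp_all add: assms comm zero_mem)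
    then have "(ev h t (smult a p') - h a * ev h t p')
        + ((ev h t (p * p') - ev h t p * ev h t p') * t
        + ev h t p * (ev h t p' * t - t * ev h t p')) \<in> I"
      by (intro add_mem rmult_mem lmult_mem pCons.IH smult)
    then show ?case
      by (simp add: ev_pCons ev_add h_0 algebra_simps)
  qed (simp add: ev_0 zero_mem)
qed

end

section \<open>Maximal ideals of \<open>K[X][Y]\<close>\<close>

text \<open>A root of \<open>p\<close> splits off a linear factor, and primeness puts this factor or
  the cofactor of smaller degree into \<open>S\<close>. It is applied to the one-variable
  polynomials whose images lie in a given ideal of two-variable ones.\<close>

lemma prime_set_contains_linear:
  fixes S :: "'k::alg_closed_field poly set"
  assumes prime: "\<And>p p'. p * p' \<in> S \<Longrightarrow> p \<in> S \<or> p' \<in> S"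
    and const: "\<And>c. c \<noteq> 0 \<Longrightarrow> [:c:] \<notin> S"
    and "p \<in> S" and "p \<noteq> 0"
  shows "\<exists>a. [:- a, 1:] \<in> S"
  using \<open>p \<in> S\<close> \<open>p \<noteq> 0\<close>
proof (induction "degree p" arbitrary: p rule: less_induct)
  case less
  have "degree p \<noteq> 0"
    using less.prems const by (metis degree_eq_zeroE pCons_eq_0_iff)
  then obtain a where "poly p a = 0"
    using alg_closed_imp_poly_has_root by blast
  then obtain p' where p: "p = [:- a, 1:] * p'"
    by (metis dvdE poly_eq_0_iff_dvd)
  then have "p' \<noteq> 0"
    using less.prems by auto
  moreover from this have "degree p = Suc (degree p')"
    unfolding p by (subst degree_mult_eq) auto
  ultimately show ?case
    using less.hyps[of p'] prime[of "[:- a, 1:]" p'] less.prems p by auto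
qed

text \<open>A root of \<open>p - 1\<close> is not a root of \<open>p\<close>.\<close>

lemma exists_nonroot:
  fixes p :: "'k::alg_closed_field poly"
  assumes "p \<noteq> 0"
  shows "\<exists>c. poly p c \<noteq> 0"
proof (cases "degree p = 0")
  case True
  then show ?thesis
    using assms by (elim degree_eq_zeroE) auto
next
  case False
  then have "degree (p - 1) \<noteq> 0"
    using degree_add_eq_left[of "- 1" p] by simp
  then obtain c where "poly (p - 1) c = 0"
    using alg_closed_imp_poly_has_root by blast
  then show ?thesis
    by (intro exI[of _ c]) simp
qed

text \<open>Maximality is phrased as invertibility modulo \<open>S\<close>, the form in which
  simplicity of a module delivers it. The outer variable is Y; the coefficients are polynomials in
  X.\<close>

locale maximal_ideal =
  fixes S :: "'k::alg_closed_field poly poly set"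
  assumes add_mem: "\<lbrakk>P \<in> S; Q \<in> S\<rbrakk> \<Longrightarrow> P + Q \<in> S"
    and mult_mem: "P \<in> S \<Longrightarrow> P * Q \<in> S"
    and proper: "1 \<notin> S"
    and maximal: "P \<notin> S \<Longrightarrow> \<exists>Q. P * Q - 1 \<in> S"
begin

lemma mult_mem': "Q \<in> S \<Longrightarrow> P * Q \<in> S"
  using mult_mem by (metis mult.commute)

lemma diff_mem: "\<lbrakk>P \<in> S; Q \<in> S\<rbrakk> \<Longrightarrow> P - Q \<in> S"
  using add_mem[of P "Q * (- 1)"] mult_mem[of Q "- 1"] by simp

lemma prime:
  assumes "P * Q \<in> S" shows "P \<in> S \<or> Q \<in> S"
proof (rule ccontr)
  assume *: "\<not> (P \<in> S \<or> Q \<in> S)"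
  then obtain R where "P * R - 1 \<in> S"
    using maximal by blast
  then have "P * Q * R - (P * R - 1) * Q \<in> S"
    by (rule diff_mem[OF mult_mem[OF assms] mult_mem])
  moreover have "P * Q * R - (P * R - 1) * Q = Q"
    by (simp add: algebra_simps)
  ultimately show False
    using * by simp
qed

lemma unit_not_mem: "P * Q = 1 \<Longrightarrow> P \<notin> S"
  using mult_mem proper by metis

text \<open>If \<open>S\<close> contains a nonzero polynomial in X, primeness suffices. Otherwise,
  as in Zariski's lemma, the residue field would be integral over K[X] localised at the leading
  coefficient \<open>p\<close> of some \<open>F\<close> in \<open>S\<close>, and this localisation
  would be a field; yet \<open>X - c\<close> is no unit there when \<open>p\<close> does not vanish
  at \<open>c\<close>.\<close>

lemma contains_X_minus: "\<exists>a. [:[:- a, 1:]:] \<in> S"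
proof (cases "\<exists>p. p \<noteq> 0 \<and> [:p:] \<in> S")
  case True
  have "\<exists>a. [:- a, 1:] \<in> {p. [:p:] \<in> S}"
  proof -
    from True obtain p where "p \<in> {p. [:p:] \<in> S}" "p \<noteq> 0" by blast
    then show ?thesis
    proof (rule prime_set_contains_linear[rotated 2])
      show "p \<in> {p. [:p:] \<in> S} \<or> p' \<in> {p. [:p:] \<in> S}" if "p * p' \<in> {p. [:p:] \<in> S}" for p p'
        using prime[of "[:p:]" "[:p':]"] that by (simp add: mult.commute)
      show "[:c:] \<notin> {p. [:p:] \<in> S}" if "c \<noteq> 0" for c
        using unit_not_mem[of "[:[:c:]:]" "[:[:inverse c:]:]"] that
        by (simp add: one_pCons)
    qed
  qed
  then show ?thesis by simp
next
  case False
  \<comment> \<open>The zero ideal has to be excluded: if Y is not in \<open>S\<close>, an inverse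
    \<open>U\<close> of Y modulo \<open>S\<close> gives the element \<open>Y U - 1\<close>, whose
    constant coefficient is -1.\<close>
  obtain F where "F \<in> S" "F \<noteq> 0"
  proof (cases "[:0, 1:] \<in> S")
    case True
    then show ?thesis using that by fastforce
  next
    case False
    then obtain U where "[:0, 1:] * U - 1 \<in> S"
      using maximal by blast
    moreover have "coeff ([:0, 1:] * U - 1) 0 \<noteq> 0"
      by simp
    ultimately show ?thesis
      using that by (metis coeff_0)
  qed
  then obtain F where F: "F \<in> S" "F \<noteq> 0"
    and least: "\<And>G. \<lbrakk>G \<in> S; G \<noteq> 0\<rbrakk> \<Longrightarrow> degree F \<le> degree G"
    using ex_has_least_nat[of "\<lambda>F. F \<in> S \<and> F \<noteq> 0" F degree] by blast
  have deg: "degree F > 0"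
    using F False by (metis degree_eq_zeroE gr0I pCons_0_0)
  define p where "p = lead_coeff F"
  obtain c where c: "poly p c \<noteq> 0"
    using exists_nonroot F(2) unfolding p_def by (metis leading_coeff_neq_0)
  have "[:[:- c, 1:]:] \<notin> S"
    using False by (metis one_neq_zero pCons_eq_0_iff)
  then obtain U where U: "[:[:- c, 1:]:] * U - 1 \<in> S"
    using maximal by blast
  obtain k Q R where QR: "smult (p ^ k) U = F * Q + R" and R: "R = 0 \<or> degree R < degree F"
    using pseudo_divmod[OF F(2), of U "fst (pseudo_divmod U F)" "snd (pseudo_divmod U F)"]
    unfolding p_def by auto
  \<comment> \<open>If \<open>X - c\<close> is invertible modulo \<open>S\<close>, pseudo-division of its inverse by \<open>F\<close> yields an
    element of \<open>S\<close> of smaller degree than \<open>F\<close>, hence \<open>(X - c) R = p\<^sup>k\<close>, contradicting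
    \<open>p(c) \<noteq> 0\<close>.\<close>
  define G where "G = [:[:- c, 1:]:] * R - [:p ^ k:]"
  have "G = [:p ^ k:] * ([:[:- c, 1:]:] * U - 1) - F * (Q * [:[:- c, 1:]:])"
  proof -
    have "R = [:p ^ k:] * U - F * Q"
      using QR by simp
    then show ?thesis
      unfolding G_def by (simp only:) (simp add: algebra_simps del: mult_pCons_left mult_pCons_right)
  qed
  then have "G \<in> S"
    by (metis diff_mem[OF mult_mem'[OF U] mult_mem[OF F(1)]])
  moreover have "degree G < degree F"
  proof -
    have "degree ([:[:- c, 1:]:] * R) < degree F"
      using R deg by (auto simp: degree_smult_eq)
    then show ?thesis
      unfolding G_def using deg by (intro degree_diff_less) auto
  qed
  ultimately have "G = 0"
    using least by fastforce
  then have "poly (coeff G 0) c = 0"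
    by simp
  moreover have "poly (coeff G 0) c = - (poly p c ^ k)"
    by (simp add: G_def)
  ultimately show ?thesis
    using c by simp
qed

text \<open>Modulo \<open>X - a\<close> each coefficient may be replaced by its value at
  \<open>a\<close>. This produces a nonzero polynomial in Y alone inside \<open>S\<close>, and the
  one-variable argument applies again.\<close>

lemma contains_Y_minus: "\<exists>b. [:[:- b:], 1:] \<in> S"
proof -
  obtain a where a: "[:[:- a, 1:]:] \<in> S"
    using contains_X_minus by blast
  have S_0: "0 \<in> S"
    using mult_mem[OF a, of 0] by simp
  have red: "P - map_poly (\<lambda>c. [:poly c a:]) P \<in> S" for P
  proof (induction P)
    case (pCons c P)
    have "[:- a, 1:] dvd c - [:poly c a:]"
      by (simp add: poly_eq_0_iff_dvd[symmetric])
    then have "[:c - [:poly c a:]:] \<in> S"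
      using mult_mem[OF a, of "[:d:]" for d] by (elim dvdE) simp
    then have "[:c - [:poly c a:]:] + [:0, 1:] * (P - map_poly (\<lambda>c. [:poly c a:]) P) \<in> S"
      by (intro add_mem mult_mem' pCons.IH)
    then show ?case
      by (simp add: map_poly_pCons)
  qed (simp add: S_0)
  \<comment> \<open>Embedding of K[Y] into K[X][Y]; its multiplicativity carries primeness of
    \<open>S\<close> back to K[Y].\<close>
  define i where "i = map_poly (\<lambda>c::'k. [:c:])"
  have i_mult: "i (p * p') = i p * i p'" and i_one: "i 1 = 1" for p p'
  proof -
    have i_add: "i (p + p') = i p + i p'" for p p'
      by (rule poly_eqI) (simp add: i_def coeff_map_poly)
    have i_smult: "i (smult c p) = smult [:c:] (i p)" for c p
      by (rule poly_eqI) (simp add: i_def coeff_map_poly)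
    show "i (p * p') = i p * i p'"
      by (induction p) (simp_all add: i_add i_smult, simp_all add: i_def map_poly_pCons)
    show "i 1 = 1"
      by (simp add: i_def one_pCons map_poly_pCons)
  qed
  obtain p where p: "p \<noteq> 0" "i p \<in> S"
  proof (cases "[:0, 1:] \<in> S")
    case True
    then show ?thesis
      using that[of "[:0, 1:]"] by (simp add: i_def map_poly_pCons one_pCons)
  next
    case False
    then obtain U where U: "[:0, 1:] * U - 1 \<in> S"
      using maximal by blast
    define p where "p = [:0, 1:] * map_poly (\<lambda>c. poly c a) U - 1"
    have "coeff p 0 \<noteq> 0"
      by (simp add: p_def)
    then have "p \<noteq> 0"
      by fastforce
    have "i p = [:0, 1:] * map_poly (\<lambda>c. [:poly c a:]) U - 1"
      by (rule poly_eqI) (simp add: p_def i_def coeff_map_poly coeff_pCons one_pCons split: nat.split)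
    also have "\<dots> = ([:0, 1:] * U - 1) - [:0, 1:] * (U - map_poly (\<lambda>c. [:poly c a:]) U)"
      by (simp add: algebra_simps del: mult_pCons_left mult_pCons_right)
    also have "\<dots> \<in> S"
      by (intro diff_mem U mult_mem' red)
    finally show ?thesis
      using that \<open>p \<noteq> 0\<close> by blast
  qed
  have "\<exists>b. [:- b, 1:] \<in> {p. i p \<in> S}"
  proof (rule prime_set_contains_linear)
    show "p \<in> {p. i p \<in> S} \<or> p' \<in> {p. i p \<in> S}" if "p * p' \<in> {p. i p \<in> S}" for p p'
      using prime that by (simp add: i_mult)
    show "[:c:] \<notin> {p. i p \<in> S}" if "c \<noteq> 0" for c
      using unit_not_mem[of "i [:c:]" "i [:inverse c:]"] that i_mult i_one
      by (simp add: one_pCons i_mult[symmetric])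
    show "p \<in> {p. i p \<in> S}" "p \<noteq> 0" using p by simp_all
  qed
  then show ?thesis
    by (simp add: i_def map_poly_pCons one_pCons)
qed

end

section \<open>Right ideals modulo the relations\<close>

text \<open>These are the \<open>t\<close>-integers, which appear whenever a generator is moved past
  a power of \<open>y\<close>.\<close>

lemma geometric_root_of_unity:
  fixes t :: "'k::field"
  assumes "primitive_root_of_unity l t" and "l > 1"
  shows "(\<Sum>i<l. t ^ i) = 0" and "\<lbrakk>0 < j; j < l\<rbrakk> \<Longrightarrow> (\<Sum>i<j. t ^ i) \<noteq> 0"
proof -
  have "t ^ 1 \<noteq> 1"
    using assms unfolding primitive_root_of_unity_def by blast
  then have "(\<Sum>i<j. t ^ i) = (t ^ j - 1) / (t - 1)" and "t - 1 \<noteq> 0" for j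
    by (simp_all add: geometric_sum)
  then show "(\<Sum>i<l. t ^ i) = 0" and "\<lbrakk>0 < j; j < l\<rbrakk> \<Longrightarrow> (\<Sum>i<j. t ^ i) \<noteq> 0"
    using assms unfolding primitive_root_of_unity_def by auto
qed

lemma primitive_root_of_unity_inverse:
  fixes t :: "'k::field"
  assumes "primitive_root_of_unity l t"
  shows "primitive_root_of_unity l (inverse t)"
  using assms by (simp add: primitive_root_of_unity_def power_inverse)

text \<open>Abstract form of the free algebra: \<open>'a\<close> is not the quotient, and the
  relations hold modulo \<open>I\<close> only. \<open>t\<close> stands for \<open>q ^ 2\<close>;
  \<open>generated\<close> is induction along right multiplications, in line with right
  modules.\<close>

locale skew_relations = two_sided_ideal I
  for I :: "'a::ring_1 set" +
  fixes s :: "'k::alg_closed_field \<Rightarrow> 'a" and x y z :: 'a and t \<alpha> \<gamma> :: 'k and l :: nat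
  assumes s_add: "s (c + d) = s c + s d"
    and s_mult: "s (c * d) = s c * s d"
    and s_1: "s 1 = 1"
    and s_central: "s c * a = a * s c"
    and generated: "\<lbrakk>P 1; \<And>a b. P a \<Longrightarrow> P b \<Longrightarrow> P (a + b); \<And>a c. P a \<Longrightarrow> P (a * s c);
      \<And>a. P a \<Longrightarrow> P (a * x); \<And>a. P a \<Longrightarrow> P (a * y); \<And>a. P a \<Longrightarrow> P (a * z)\<rbrakk> \<Longrightarrow> P a"
    and rel_xy: "x * y - (s t * y * x + s \<alpha>) \<in> I"
    and rel_xz: "x * z - s (inverse t) * z * x \<in> I"
    and rel_yz: "y * z - (s t * z * y + s \<gamma>) \<in> I"
    and root: "primitive_root_of_unity l t" and l: "l > 1" and \<gamma>: "\<gamma> \<noteq> 0"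
begin

lemma s_0: "s 0 = 0"
  using s_add[of 0 0] by simp

lemma s_minus: "s (- c) = - s c"
  using s_add[of c "- c"] s_0 by (simp add: add_eq_0_iff)

lemma t_nonzero: "t \<noteq> 0"
  using root unfolding primitive_root_of_unity_def by (metis power_eq_0_iff zero_neq_one)

lemma s_inverse: "c \<noteq> 0 \<Longrightarrow> s c * s (inverse c) = 1"
  using s_mult[of c "inverse c"] s_1 by simp

text \<open>Solving for \<open>y * x\<close> gives the shape
  \<open>y * a = s \<sigma> * a * y + s \<epsilon>\<close> shared with \<open>rel_yz\<close>, so
  that \<open>power_commute\<close> treats \<open>x\<close> and \<open>z\<close> alike.\<close>

lemma rel_yx: "y * x - (s (inverse t) * x * y + s (- (inverse t * \<alpha>))) \<in> I"
proof -
  have "- s (inverse t) * (x * y - (s t * y * x + s \<alpha>)) \<in> I"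
    by (rule lmult_mem[OF rel_xy])
  moreover have "s (inverse t) * (s t * (y * x)) = y * x"
    using s_mult[of "inverse t" t] t_nonzero s_1 by (simp add: mult.assoc[symmetric])
  ultimately show ?thesis
    using s_central[of \<alpha> "s (inverse t)"] by (simp add: algebra_simps s_minus s_mult)
qed

text \<open>Each \<open>y\<close> that passes \<open>a\<close> contributes a factor \<sigma> and a
  remainder; the remainders add up to a \<sigma>-integer. For \<open>k = 0\<close> this sum is
  empty, so the truncated exponent \<open>k - 1\<close> is harmless.\<close>

lemma power_commute:
  assumes "y * a - (s \<sigma> * a * y + s \<epsilon>) \<in> I"
  shows "y ^ k * a - (s (\<sigma> ^ k) * a * y ^ k + s (\<epsilon> * (\<Sum>i<k. \<sigma> ^ i)) * y ^ (k - 1)) \<in> I"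
proof (induction k)
  case 0
  then show ?case by (simp add: s_1 s_0 zero_mem)
next
  case (Suc k)
  have *: "y * (s c * y ^ (k - 1)) = s c * y ^ k" if "k = 0 \<Longrightarrow> c = 0" for c
    using that by (cases k) (simp_all add: s_0 s_central mult.assoc power_commutes)
  define A B W where "A = s (\<sigma> ^ k)" and "B = s (\<epsilon> * (\<Sum>i<k. \<sigma> ^ i))"
    and "W = y ^ (k - 1)"
  have B: "y * (B * W) = B * y ^ k"
    unfolding B_def W_def by (rule *) auto
  have A: "y * (A * w) = A * (y * w)" for w
    unfolding A_def by (metis s_central mult.assoc)
  have "s (\<epsilon> * (\<Sum>i<Suc k. \<sigma> ^ i)) = A * s \<epsilon> + B"
    by (simp add: A_def B_def s_add[symmetric] s_mult[symmetric] algebra_simps)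
  moreover have "s (\<sigma> ^ Suc k) = A * s \<sigma>"
    by (simp add: A_def s_mult[symmetric] mult.commute)
  moreover have "y * (y ^ k * a - (A * a * y ^ k + B * W))
      + A * (y * a - (s \<sigma> * a * y + s \<epsilon>)) * y ^ k \<in> I"
    unfolding A_def B_def W_def by (intro add_mem lmult_mem rmult_mem Suc.IH assms)
  moreover have "y * (y ^ k * a - (A * a * y ^ k + B * W))
      + A * (y * a - (s \<sigma> * a * y + s \<epsilon>)) * y ^ k
      = y ^ Suc k * a - (A * s \<sigma> * a * y ^ Suc k + (A * s \<epsilon> + B) * y ^ k)"
    by (simp add: algebra_simps A B)
  ultimately show ?case
    by simp
qed

lemmas power_commute_x = power_commute[OF rel_yx]
lemmas power_commute_z = power_commute[OF rel_yz]

text \<open>At \<open>k = l\<close> the factor in \<open>power_commute_x\<close> is 1 and the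
  remainder vanishes, the inverse of \<open>t\<close> being a primitive root of unity as
  well.\<close>

lemma power_l_commute_x: "x * y ^ l - y ^ l * x \<in> I"
proof -
  note root' = primitive_root_of_unity_inverse[OF root]
  have "inverse t ^ l = 1" and "(\<Sum>i<l. inverse t ^ i) = 0"
    using root' geometric_root_of_unity(1)[OF root' l] by (simp_all only: primitive_root_of_unity_def)
  then have "y ^ l * x - x * y ^ l \<in> I"
    using power_commute_x[of l] by (simp only: s_0 s_1 mult_zero_left mult_zero_right mult_1_left add_0_right)
  then show ?thesis
    by (rule diff_swap)
qed

lemma power_l_commute_z: "y ^ l * z - z * y ^ l \<in> I"
proof -
  have "t ^ l = 1" and "(\<Sum>i<l. t ^ i) = 0"
    using root geometric_root_of_unity(1)[OF root l] by (simp_all only: primitive_root_of_unity_def)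
  then show ?thesis
    using power_commute_z[of l] by (simp only: s_0 s_1 mult_zero_left mult_zero_right mult_1_left add_0_right)
qed

text \<open>
  \<open>C\<close> plays the role of a coefficient space inside the kernel of \<open>z\<close> on the module of
  residues modulo \<open>J\<close>: the submodule it generates is then \<open>\<Sum>\<^bsub>j<l\<^esub> C y\<^sup>j\<close>.
\<close>
definition coefficients :: "'a set \<Rightarrow> 'a set \<Rightarrow> bool"
  where "coefficients J C \<longleftrightarrow> 0 \<in> C \<and> (\<forall>u\<in>C. \<forall>v\<in>C. u + v \<in> C) \<and>
    (\<forall>u\<in>C. \<forall>c. u * s c \<in> C) \<and> (\<forall>u\<in>C. u * x \<in> C \<and> u * y ^ l \<in> C \<and> u * z \<in> J)"

lemma coefficientsI:
  assumes "0 \<in> C" and "\<And>u v. \<lbrakk>u \<in> C; v \<in> C\<rbrakk> \<Longrightarrow> u + v \<in> C"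
    and "\<And>u c. u \<in> C \<Longrightarrow> u * s c \<in> C" and "\<And>u. u \<in> C \<Longrightarrow> u * x \<in> C"
    and "\<And>u. u \<in> C \<Longrightarrow> u * y ^ l \<in> C" and "\<And>u. u \<in> C \<Longrightarrow> u * z \<in> J"
  shows "coefficients J C"
  unfolding coefficients_def by (intro conjI ballI allI) (simp_all add: assms)

lemma coefficientsD:
  assumes "coefficients J C"
  shows "0 \<in> C" and "\<lbrakk>u \<in> C; v \<in> C\<rbrakk> \<Longrightarrow> u + v \<in> C" and "u \<in> C \<Longrightarrow> u * s c \<in> C"
    and "u \<in> C \<Longrightarrow> u * x \<in> C" and "u \<in> C \<Longrightarrow> u * y ^ l \<in> C" and "u \<in> C \<Longrightarrow> u * z \<in> J"
  using assms unfolding coefficients_def by simp_all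

text \<open>The set \<open>T\<close> of elements with such an expansion is closed under right
  multiplication by generators: \<open>x\<close> moves left past \<open>y ^ j\<close> into the
  coefficient, \<open>z\<close> moves left and is killed modulo \<open>J\<close>, and an overflowing
  \<open>y ^ l\<close> is absorbed by the coefficient.\<close>

lemma normal_form:
  assumes J: "right_ideal J" "I \<subseteq> J" and C: "coefficients J C" and u: "u \<in> C"
  shows "\<exists>c. (\<forall>j. c j \<in> C) \<and> u * a - (\<Sum>j<l. c j * y ^ j) \<in> J"
proof -
  interpret J: right_ideal J by fact
  note C_0 = coefficientsD(1)[OF C] and C_add = coefficientsD(2)[OF C]
    and C_s = coefficientsD(3)[OF C] and C_x = coefficientsD(4)[OF C]
    and C_y = coefficientsD(5)[OF C] and C_z = coefficientsD(6)[OF C]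
  define T where "T = {a. \<exists>c. (\<forall>j. c j \<in> C) \<and> a - (\<Sum>j<l. c j * y ^ j) \<in> J}"
  have T_add: "a + b \<in> T" if ab: "a \<in> T" "b \<in> T" for a b
  proof -
    obtain c d where "\<And>j. c j \<in> C" "a - (\<Sum>j<l. c j * y ^ j) \<in> J"
      and "\<And>j. d j \<in> C" "b - (\<Sum>j<l. d j * y ^ j) \<in> J"
      using ab unfolding T_def by blast
    then show ?thesis
      unfolding T_def using J.diff_add
      by (intro CollectI exI[of _ "\<lambda>j. c j + d j"]) (auto simp: C_add distrib_right sum.distrib)
  qed
  have T_J: "a \<in> T" if "a - b \<in> J" "b \<in> T" for a b
    using that J.diff_trans unfolding T_def by blast
  have T_0: "0 \<in> T"
    unfolding T_def by (intro CollectI exI[of _ "\<lambda>_. 0"]) (simp add: C_0 J.zero_mem)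
  have T_sum: "(\<Sum>j\<in>A. f j) \<in> T" if "\<And>j. j \<in> A \<Longrightarrow> f j \<in> T" for f :: "nat \<Rightarrow> 'a" and A
    using that by (induction A rule: infinite_finite_induct) (simp_all add: T_0 T_add)
  have T_mono: "u * y ^ j \<in> T" if "u \<in> C" "j \<le> l" for u j
  proof (cases "j = l")
    case True
    then show ?thesis
      unfolding T_def using that l C_0 C_y J.zero_mem
      by (intro CollectI exI[of _ "\<lambda>i. if i = 0 then u * y ^ l else 0"])
        (simp add: if_distrib[of "\<lambda>c. c * _"] sum.delta cong: if_cong)
  next
    case False
    then show ?thesis
      unfolding T_def using that C_0 J.zero_mem
      by (intro CollectI exI[of _ "\<lambda>i. if i = j then u else 0"])
        (simp add: if_distrib[of "\<lambda>c. c * _"] sum.delta cong: if_cong)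
  qed
  have T_rmult: "a * g \<in> T" if a: "a \<in> T" and g: "\<And>u j. \<lbrakk>u \<in> C; j < l\<rbrakk> \<Longrightarrow> u * y ^ j * g \<in> T" for a g
  proof -
    obtain c where c: "\<And>j. c j \<in> C" "a - (\<Sum>j<l. c j * y ^ j) \<in> J"
      using a unfolding T_def by blast
    have "a * g - (\<Sum>j<l. c j * y ^ j) * g \<in> J"
      by (rule J.diff_rmult) fact
    moreover have "(\<Sum>j<l. c j * y ^ j) * g \<in> T"
      using c g by (auto simp: sum_distrib_right intro!: T_sum)
    ultimately show ?thesis
      by (rule T_J)
  qed
  \<comment> \<open>The alternative \<open>u * a \<in> C\<close> serves \<open>a = x\<close>, the
    alternative \<open>u * a \<in> J\<close> serves \<open>a = z\<close>.\<close>
  have expand: "u * y ^ j * a \<in> T"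
    if u: "u \<in> C" and j: "j < l" and ua: "u * a \<in> C \<or> u * a \<in> J"
      and rel: "y ^ j * a - (s c * a * y ^ j + s d * y ^ (j - 1)) \<in> I" for u j a c d
  proof -
    have "u * (y ^ j * a - (s c * a * y ^ j + s d * y ^ (j - 1))) \<in> J"
      using lmult_mem[OF rel] J(2) by blast
    then have "u * y ^ j * a - (u * a * s c * y ^ j + u * s d * y ^ (j - 1)) \<in> J"
      by (simp add: algebra_simps s_central[of c])
    moreover have "u * a * s c * y ^ j \<in> T"
      using ua
    proof
      assume "u * a \<in> C"
      then show ?thesis using C_s T_mono j by simp
    next
      assume "u * a \<in> J"
      then show ?thesis using T_J[OF _ T_0] by (simp add: J.rmult_mem)
    qed
    moreover have "u * s d * y ^ (j - 1) \<in> T"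
      using C_s T_mono j u by simp
    ultimately show ?thesis
      using T_J T_add by blast
  qed
  have "u * a \<in> T"
  proof (induction a rule: generated)
    case 1
    then show ?case using T_mono[OF u, of 0] by simp
  next
    case (2 a b)
    then show ?case by (simp add: distrib_left T_add)
  next
    case (3 a c)
    have "v * y ^ j * s c \<in> T" if "v \<in> C" "j < l" for v j
      using T_mono[of "v * s c" j] that C_s by (simp add: mult.assoc s_central)
    from T_rmult[OF 3 this] show ?case by (simp add: mult.assoc)
  next
    case (4 a)
    have "v * y ^ j * x \<in> T" if "v \<in> C" "j < l" for v j
      using expand[OF that _ power_commute_x] C_x that by blast
    from T_rmult[OF 4 this] show ?case by (simp add: mult.assoc)
  next
    case (5 a)
    have "v * y ^ j * y \<in> T" if "v \<in> C" "j < l" for v j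
      using T_mono[of v "Suc j"] that by (simp add: mult.assoc power_commutes)
    from T_rmult[OF 5 this] show ?case by (simp add: mult.assoc)
  next
    case (6 a)
    have "v * y ^ j * z \<in> T" if "v \<in> C" "j < l" for v j
      using expand[OF that _ power_commute_z] C_z that by blast
    from T_rmult[OF 6 this] show ?case by (simp add: mult.assoc)
  qed
  then show ?thesis
    unfolding T_def by blast
qed

text \<open>Right multiplication by \<open>z\<close> lowers the exponent of \<open>y\<close>.\<close>
lemma independent:
  assumes J: "right_ideal J" "I \<subseteq> J" and C: "coefficients J C"
    and c: "\<And>j. c j \<in> C" and "n < l" and "(\<Sum>j\<le>n. c j * y ^ j) \<in> J" and "j \<le> n"
  shows "c j \<in> J"
  using assms(4-)
proof (induction n arbitrary: c j)
  case 0
  then show ?case by simp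
next
  case (Suc n)
  interpret J: right_ideal J by fact
  note C_s = coefficientsD(3)[OF C] and C_z = coefficientsD(6)[OF C]
  \<comment> \<open>Scalar left behind when \<open>z\<close> passes \<open>y ^ j\<close>; it is
    invertible for \<open>0 < j < l\<close>, so the induction hypothesis for the shifted sum gives
    back the coefficients themselves.\<close>
  define e where "e j = \<gamma> * (\<Sum>i<j. t ^ i)" for j
  have lower: "c j * y ^ j * z - c j * s (e j) * y ^ (j - 1) \<in> J" for j
  proof -
    have "c j * (y ^ j * z - (s (t ^ j) * z * y ^ j + s (e j) * y ^ (j - 1))) \<in> J"
      using lmult_mem[OF power_commute_z] J(2) unfolding e_def by blast
    moreover have "c j * z * (s (t ^ j) * y ^ j) \<in> J"
      by (intro J.rmult_mem C_z Suc.prems)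
    ultimately have "c j * (y ^ j * z - (s (t ^ j) * z * y ^ j + s (e j) * y ^ (j - 1)))
        + c j * z * (s (t ^ j) * y ^ j) \<in> J"
      by (rule J.add_mem)
    then show ?thesis
      by (simp add: algebra_simps s_central[of "t ^ j"])
  qed
  have "(\<Sum>j\<le>Suc n. c j * y ^ j) * z
      - (\<Sum>j\<le>Suc n. c j * y ^ j * z - c j * s (e j) * y ^ (j - 1)) \<in> J"
    by (intro J.diff_mem J.rmult_mem Suc.prems J.sum_mem lower)
  also have "(\<Sum>j\<le>Suc n. c j * y ^ j) * z
      - (\<Sum>j\<le>Suc n. c j * y ^ j * z - c j * s (e j) * y ^ (j - 1))
      = (\<Sum>j\<le>Suc n. c j * s (e j) * y ^ (j - 1))"
    by (simp only: sum_distrib_right sum_subtractf) simp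
  also have "\<dots> = (\<Sum>j\<le>n. c (Suc j) * s (e (Suc j)) * y ^ j)"
    by (subst sum.atMost_Suc_shift) (simp add: e_def s_0)
  finally have shifted: "(\<Sum>j\<le>n. c (Suc j) * s (e (Suc j)) * y ^ j) \<in> J" .
  have upper: "c (Suc j) \<in> J" if "j \<le> n" for j
  proof -
    have "c (Suc j) * s (e (Suc j)) \<in> J"
      using Suc.IH[of "\<lambda>j. c (Suc j) * s (e (Suc j))" j] Suc.prems C_s shifted that by simp
    then have "c (Suc j) * s (e (Suc j)) * s (inverse (e (Suc j))) \<in> J"
      by (rule J.rmult_mem)
    moreover have "e (Suc j) \<noteq> 0"
      unfolding e_def using geometric_root_of_unity(2)[OF root l, of "Suc j"] \<gamma> that \<open>Suc n < l\<close>
      by simp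
    ultimately show ?thesis
      by (simp add: mult.assoc s_inverse)
  qed
  \<comment> \<open>Multiplication by \<open>z\<close> loses \<open>c 0\<close>, as
    \<open>e 0 = 0\<close>; it is recovered by subtracting the higher terms from the original
    sum.\<close>
  have "(\<Sum>j\<le>Suc n. c j * y ^ j) - (\<Sum>j\<le>n. c (Suc j) * y ^ Suc j) \<in> J"
    by (intro J.diff_mem Suc.prems J.sum_mem J.rmult_mem upper) simp
  then have "c 0 \<in> J"
    by (subst (asm) sum.atMost_Suc_shift) simp
  then show ?case
    using upper Suc.prems(4) by (cases j) auto
qed

lemma lessThan_eq_atMost: "{..<l} = {..l - 1}"
  using l by auto

text \<open>Here the coefficients of a normal form can be taken to be scalars, the same ones modulo
  both ideals. For an element of \<open>J'\<close> they vanish by independence and properness of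
  \<open>J'\<close>, so the element lies in \<open>J\<close> too.\<close>

lemma right_ideal_subset:
  assumes J: "right_ideal J" "I \<subseteq> J" "z \<in> J" "x - s a \<in> J" "y ^ l - s b \<in> J"
    and J': "right_ideal J'" "I \<subseteq> J'" "z \<in> J'" "x - s a \<in> J'" "y ^ l - s b \<in> J'" "1 \<notin> J'"
  shows "J' \<subseteq> J"
proof
  fix p assume p: "p \<in> J'"
  interpret J: right_ideal J by fact
  interpret J': right_ideal J' by fact
  define C where "C H = {u. \<exists>c. u - s c \<in> H}" for H :: "'a set"
  have coeff: "coefficients H (C H)"
    if "right_ideal H" "z \<in> H" "x - s a \<in> H" "y ^ l - s b \<in> H" for H
  proof -
    interpret H: right_ideal H by fact
    have mult: "u * g - s (c * d) \<in> H" if "u - s c \<in> H" "g - s d \<in> H" for u g c d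
    proof -
      have "(u - s c) * g + (g - s d) * s c \<in> H"
        by (intro H.add_mem H.rmult_mem that)
      then show ?thesis
        using s_central[of c g] s_central[of c "s d"] by (simp add: algebra_simps s_mult)
    qed
    show ?thesis
    proof (rule coefficientsI)
      show "0 \<in> C H"
        unfolding C_def by (intro CollectI exI[of _ 0]) (simp add: s_0 H.zero_mem)
    next
      fix u v assume "u \<in> C H" "v \<in> C H"
      then obtain c d where "u - s c \<in> H" "v - s d \<in> H"
        unfolding C_def by blast
      then have "u + v - s (c + d) \<in> H"
        using H.diff_add by (simp add: s_add)
      then show "u + v \<in> C H"
        unfolding C_def by blast
    next
      fix u assume "u \<in> C H"
      then obtain c where u: "u - s c \<in> H"
        unfolding C_def by blast
      have "u * s d - s (c * d) \<in> H" for d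
        using mult[OF u, of "s d" d] by (simp add: H.zero_mem)
      then show "u * s d \<in> C H" for d
        unfolding C_def by blast
      show "u * x \<in> C H" "u * y ^ l \<in> C H"
        using mult[OF u] that(3,4) unfolding C_def by blast+
      show "u * z \<in> H"
        using mult[OF u, of z 0] that(2) by (simp add: s_0)
    qed
  qed
  have "1 \<in> C (J \<inter> J')"
    unfolding C_def by (intro CollectI exI[of _ 1]) (simp add: s_1 J.zero_mem J'.zero_mem)
  moreover have "right_ideal (J \<inter> J')"
    using right_ideal_Int J(1) J'(1) .
  moreover have "coefficients (J \<inter> J') (C (J \<inter> J'))"
    using coeff[OF \<open>right_ideal (J \<inter> J')\<close>] J J' by simp
  \<comment> \<open>Working modulo the intersection yields one expansion of \<open>p\<close> valid
    for both ideals.\<close>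
  ultimately obtain c where c: "\<And>j. c j \<in> C (J \<inter> J')"
    and "1 * p - (\<Sum>j<l. c j * y ^ j) \<in> J \<inter> J'"
    using normal_form[of "J \<inter> J'" "C (J \<inter> J')" 1 p] J(2) J'(2) by auto
  then have pJ: "p - (\<Sum>j<l. c j * y ^ j) \<in> J" and pJ': "p - (\<Sum>j<l. c j * y ^ j) \<in> J'"
    by simp_all
  have "c j \<in> J" if "j < l" for j
  proof -
    have "(\<Sum>j\<le>l - 1. c j * y ^ j) \<in> J'"
      using J'.diff_mem_iff[OF pJ'] p by (simp add: lessThan_eq_atMost)
    moreover have "c j \<in> C J'" for j
      using c unfolding C_def by blast
    moreover have "l - 1 < l" "j \<le> l - 1"
      using that by simp_all
    ultimately have "c j \<in> J'"
      using independent[OF J'(1,2) coeff[OF J'(1,3-5)]] by blast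
    moreover obtain d where d: "c j - s d \<in> J \<inter> J'"
      using c unfolding C_def by blast
    ultimately have "s d \<in> J'"
      using J'.diff_mem_iff by blast
    then have "d = 0"
      using J'.rmult_mem[of "s d" "s (inverse d)"] s_inverse J'(6) by fastforce
    then show ?thesis
      using d by (simp add: s_0)
  qed
  then have "(\<Sum>j<l. c j * y ^ j) \<in> J"
    by (intro J.sum_mem J.rmult_mem) simp
  then show "p \<in> J"
    using J.diff_mem_iff[OF pJ] by blast
qed

lemma right_ideal_eq:
  assumes "right_ideal J" "I \<subseteq> J" "z \<in> J" "x - s a \<in> J" "y ^ l - s b \<in> J" "1 \<notin> J"
    and "right_ideal J'" "I \<subseteq> J'" "z \<in> J'" "x - s a \<in> J'" "y ^ l - s b \<in> J'" "1 \<notin> J'"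
  shows "J = J'"
  using right_ideal_subset assms by blast

text \<open>The polynomials \<open>P\<close> with \<open>E P \<in> J\<close> form a maximal ideal of
  K[X][Y], so the Nullstellensatz supplies \<open>a\<close> and \<open>b\<close>. The point is to
  replace an inverse of \<open>E P\<close> modulo \<open>J\<close> by one of the form
  \<open>E Q\<close>.\<close>

lemma maximal_right_ideal_eigenvalues:
  assumes J: "right_ideal J" "I \<subseteq> J" and proper: "1 \<notin> J"
    and maximal: "\<And>p. p \<notin> J \<Longrightarrow> \<exists>a. p * a - 1 \<in> J" and z: "z \<in> J"
  shows "\<exists>a b. x - s a \<in> J \<and> y ^ l - s b \<in> J"
proof -
  interpret J: right_ideal J by fact
  have ideal: "two_sided_ideal I" by unfold_locales
  interpret hx: evaluation s x
    by unfold_locales (simp_all add: s_0 s_add)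
  interpret hY: evaluation "ev s x" "y ^ l"
    by unfold_locales (simp_all add: hx.ev_0 hx.ev_add)
  \<comment> \<open>Evaluation of two-variable polynomials at X = \<open>x\<close>, Y =
    \<open>y ^ l\<close>.\<close>
  define E where "E = ev (ev s x) (y ^ l)"
  have hx_mult: "ev s x (p * p') - ev s x p * ev s x p' \<in> I" for p p'
    by (rule hx.ev_mult) (simp_all only: ideal s_mult s_central[of _ x] diff_self zero_mem)
  have "ev s x p * y ^ l - y ^ l * ev s x p \<in> I" for p
    by (rule hx.ev_commute)
      (simp_all only: ideal s_central[of _ "y ^ l"] diff_self zero_mem power_l_commute_x)
  then have E_mult: "E (P * Q) - E P * E Q \<in> I" for P Q
    unfolding E_def by (intro hY.ev_mult ideal hx_mult)
  have E_0: "E 0 = 0" and E_add: "E (P + Q) = E P + E Q" and E_diff: "E (P - Q) = E P - E Q" for P Q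
    unfolding E_def by (simp_all add: hY.ev_0 hY.ev_add hY.ev_diff)
  have E_s: "E [:[:c:]:] = s c" for c
    by (simp add: E_def hY.ev_const hx.ev_const)
  have E_x: "E [:[:a, 1:]:] = x + s a" for a
    by (simp add: E_def hY.ev_const hx.ev_pCons hx.ev_0 s_0 s_1)
  have E_y: "E [:[:a:], 1:] = y ^ l + s a" for a
    by (simp add: E_def hY.ev_pCons hY.ev_0 hx.ev_const hx.ev_0 one_pCons s_1)
  have E_1: "E 1 = 1"
    using E_s[of 1] by (simp add: one_pCons s_1)
  \<comment> \<open>The kernel of \<open>z\<close> is stable under \<open>x\<close>, since
    \<open>x * z\<close> is a scalar multiple of \<open>z * x\<close> modulo
    \<open>I\<close>.\<close>
  have hx_z: "ev s x p \<in> {u. u * z \<in> J}" for p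
  proof (rule hx.ev_closed)
    fix a assume "a \<in> {u. u * z \<in> J}"
    then have "a * z * (s (inverse t) * x) + a * (x * z - s (inverse t) * z * x) \<in> J"
      by (intro J.add_mem subsetD[OF J(2) lmult_mem[OF rel_xz]] J.rmult_mem[of "a * z"]) simp
    then show "a * x \<in> {u. u * z \<in> J}"
      by (simp add: algebra_simps s_central)
  qed (simp_all add: J.zero_mem J.add_mem J.rmult_mem distrib_right z s_central[of _ z])
  have "E P \<in> {u. u * z \<in> J}" for P
    unfolding E_def
  proof (rule hY.ev_closed)
    fix a assume "a \<in> {u. u * z \<in> J}"
    then have "a * z * y ^ l + a * (y ^ l * z - z * y ^ l) \<in> J"
      by (intro J.add_mem subsetD[OF J(2) lmult_mem[OF power_l_commute_z]]
          J.rmult_mem[of "a * z"]) simp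
    then show "a * y ^ l \<in> {u. u * z \<in> J}"
      by (simp add: algebra_simps)
  qed (use hx_z in \<open>simp_all add: J.zero_mem J.add_mem distrib_right\<close>)
  then have E_z: "E P * z \<in> J" for P
    by blast
  \<comment> \<open>Restricting the coefficients to multiples of \<open>P\<close> keeps track of the
    factor \<open>E P\<close> through the normal form.\<close>
  define C where "C P = {u. \<exists>Q. u - E (P * Q) \<in> J}" for P
  have C_closed: "coefficients J (C P)" for P
  proof -
    have mult: "u * E R \<in> C P" if "u \<in> C P" for u R
    proof -
      obtain Q where "u - E (P * Q) \<in> J"
        using \<open>u \<in> C P\<close> unfolding C_def by blast
      then have "u * E R - E (P * Q) * E R \<in> J"
        by (rule J.diff_rmult)
      moreover have "E (P * Q) * E R - E (P * (Q * R)) \<in> J"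
        using J.diff_swap[OF subsetD[OF J(2) E_mult[of "P * Q" R]]] by (simp add: mult.assoc)
      ultimately show ?thesis
        unfolding C_def using J.diff_trans by blast
    qed
    have x: "x = E [:[:0, 1:]:]" and y: "y ^ l = E [:[:0:], 1:]"
      by (simp_all only: E_x E_y s_0 add_0_right)
    show ?thesis
    proof (rule coefficientsI)
      show "0 \<in> C P"
        unfolding C_def by (intro CollectI exI[of _ 0]) (simp add: E_0 J.zero_mem)
    next
      fix u v assume "u \<in> C P" "v \<in> C P"
      then obtain Q R where "u - E (P * Q) \<in> J" "v - E (P * R) \<in> J"
        unfolding C_def by blast
      then have "u + v - E (P * (Q + R)) \<in> J"
        using J.diff_add[of u "E (P * Q)" v "E (P * R)"] by (simp add: distrib_left E_add)
      then show "u + v \<in> C P"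
        unfolding C_def by blast
    next
      fix u assume "u \<in> C P"
      then obtain Q where "u - E (P * Q) \<in> J"
        unfolding C_def by blast
      then show "u * z \<in> J"
        using J.diff_mem_iff[OF J.diff_rmult, of u "E (P * Q)" z] E_z by simp
    next
      show "u * s c \<in> C P" if "u \<in> C P" for u c
        using mult[OF that, of "[:[:c:]:]"] by (simp only: E_s)
    next
      show "u * x \<in> C P" if "u \<in> C P" for u
        unfolding x by (rule mult) fact
    next
      show "u * y ^ l \<in> C P" if "u \<in> C P" for u
        unfolding y by (rule mult) fact
    qed
  qed
  have "\<exists>Q. E (P * Q - 1) \<in> J" if P: "E P \<notin> J" for P
  proof -
    obtain a where a: "E P * a - 1 \<in> J"
      using maximal[OF P] by blast
    have "E P \<in> C P"
      unfolding C_def by (intro CollectI exI[of _ 1]) (simp add: J.zero_mem)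
    then obtain c where c: "\<And>j. c j \<in> C P" and ca: "E P * a - (\<Sum>j<l. c j * y ^ j) \<in> J"
      using normal_form[OF J C_closed] by blast
    \<comment> \<open>Subtracting 1 at exponent 0 makes the whole sum lie in \<open>J\<close>. The
      new coefficients belong to \<open>C 1\<close>, since 1 need not be a multiple of
      \<open>P\<close>; independence then gives \<open>c 0 - 1 \<in> J\<close>.\<close>
    define c' where "c' j = (if j = 0 then c 0 - 1 else c j)" for j
    have "(\<Sum>j\<le>l - 1. c' j * y ^ j) = (\<Sum>j<l. c j * y ^ j) - 1"
    proof -
      have "(\<Sum>j\<le>l - 1. c' j * y ^ j) = (\<Sum>j<l. c j * y ^ j - (if j = 0 then 1 else 0))"
        unfolding lessThan_eq_atMost by (rule sum.cong) (auto simp: c'_def algebra_simps)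
      then show ?thesis
        using l by (simp add: sum_subtractf)
    qed
    moreover have "(\<Sum>j<l. c j * y ^ j) - 1 \<in> J"
      using J.diff_trans[OF J.diff_swap[OF ca] a] .
    moreover have "c' j \<in> C 1" for j
    proof -
      obtain Q where Q: "c j - E (P * Q) \<in> J" using c unfolding C_def by blast
      have "c' j - E (1 * (P * Q - (if j = 0 then 1 else 0))) \<in> J"
        using Q by (cases "j = 0") (simp_all add: c'_def E_diff E_1 E_0)
      then show ?thesis unfolding C_def by blast
    qed
    ultimately have "c' 0 \<in> J"
      using independent[OF J C_closed, of c' 1 "l - 1" 0] l by simp
    moreover obtain Q where "c 0 - E (P * Q) \<in> J"
      using c unfolding C_def by blast
    ultimately have "E (P * Q - 1) \<in> J"
      using J.diff_trans[OF J.diff_swap, of "c 0" "E (P * Q)" 1] by (simp add: c'_def E_diff E_1)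
    then show ?thesis ..
  qed
  then interpret S: maximal_ideal "{P. E P \<in> J}"
    using E_mult J(2) J.diff_mem_iff J.rmult_mem proper
    by unfold_locales (auto simp: E_add E_1 J.add_mem, blast+)
  obtain a b where "E [:[:- a, 1:]:] \<in> J" "E [:[:- b:], 1:] \<in> J"
    using S.contains_X_minus S.contains_Y_minus by blast
  then show ?thesis
    by (auto simp: E_x E_y s_minus)
qed

end

section \<open>The free algebra and its quotient\<close>

lemma poly_mapping_single_induct:
  fixes p :: "'a \<Rightarrow>\<^sub>0 'b::comm_monoid_add"
  assumes single: "\<And>k c. P (Poly_Mapping.single k c)" and add: "\<And>a b. \<lbrakk>P a; P b\<rbrakk> \<Longrightarrow> P (a + b)"
  shows "P p"
proof -
  have "(\<Sum>k\<in>Poly_Mapping.keys p. Poly_Mapping.single k (Poly_Mapping.lookup p k)) = p"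
    by (rule poly_mapping_eqI) (simp add: lookup_sum lookup_single when_def in_keys_iff)
  \<comment> \<open>The instance \<open>single undefined 0\<close> is the zero element and covers
    empty sums.\<close>
  moreover have "P (\<Sum>k\<in>A. Poly_Mapping.single k (Poly_Mapping.lookup p k))" for A
    using single[of undefined 0]
    by (induction A rule: infinite_finite_induct) (simp_all add: single add)
  ultimately show ?thesis
    by metis
qed

lemma single_Word_snoc:
  "Poly_Mapping.single (Word (ws @ [g])) 1 = Poly_Mapping.single (Word ws) (1::'k::field) * fgen g"
  by (simp add: fgen_def mult_single plus_word_def)

lemma fscal_mult: "fscal (c * d) = fscal c * fscal d"
  by (simp add: fscal_def mult_single)

lemma fscal_add: "fscal (c + d) = fscal c + fscal d"
  by (simp add: fscal_def single_add)

lemma fscal_1: "fscal 1 = 1"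
  by (simp add: fscal_def)

lemma fscal_central: "fscal c * p = p * fscal c"
  by (induction p rule: poly_mapping_single_induct)
    (simp_all add: fscal_def mult_single mult.commute distrib_left distrib_right)

lemma free_algebra_induct:
  assumes "P 1" and add: "\<And>a b. \<lbrakk>P a; P b\<rbrakk> \<Longrightarrow> P (a + b)" and scal: "\<And>a c. P a \<Longrightarrow> P (a * fscal c)"
    and gen: "\<And>a g. P a \<Longrightarrow> P (a * fgen g)"
  shows "P p"
proof (induction p rule: poly_mapping_single_induct)
  case (1 w c)
  have "P (Poly_Mapping.single (Word ws) 1)" for ws
  proof (induction ws rule: rev_induct)
    case Nil
    then show ?case using \<open>P 1\<close> by (simp flip: zero_word_def)
  next
    case (snoc g ws)
    then show ?case using gen by (simp add: single_Word_snoc)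
  qed
  from scal[OF this, of "letters w" c] show ?case
    by (simp add: fscal_def mult_single)
next
  case (2 a b)
  then show ?case by (rule add)
qed

lemma ring_free_algebra: "ring (free_algebra :: (word \<Rightarrow>\<^sub>0 'k::field) ring)"
  by (unfold_locales)
    (auto simp: free_algebra_def Units_def algebra_simps intro: exI[of _ "- x" for x])

lemma ideal_free_algebraI:
  fixes K :: "(word \<Rightarrow>\<^sub>0 'k::field) set"
  assumes "two_sided_ideal K"
  shows "ideal K free_algebra"
proof -
  interpret two_sided_ideal K by fact
  interpret ring "free_algebra :: (word \<Rightarrow>\<^sub>0 'k) ring" by (rule ring_free_algebra)
  show ?thesis
  proof (rule idealI[OF ring_free_algebra])
    show "subgroup K (add_monoid free_algebra)"
    proof (rule add.subgroupI)
      show "\<ominus>\<^bsub>free_algebra\<^esub> a \<in> K" if "a \<in> K" for a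
      proof -
        have "\<ominus>\<^bsub>free_algebra\<^esub> a = - a"
          by (rule minus_equality) (simp_all add: free_algebra_def)
        then show ?thesis using that uminus_mem by simp
      qed
    qed (use zero_mem add_mem in \<open>auto simp: free_algebra_def\<close>)
  qed (auto simp: free_algebra_def lmult_mem rmult_mem)
qed

context
  fixes q \<alpha> \<gamma> :: "'k::field"
begin

definition res :: "(word \<Rightarrow>\<^sub>0 'k) \<Rightarrow> (word \<Rightarrow>\<^sub>0 'k) set"
  where "res p = A_ideal q \<alpha> \<gamma> +>\<^bsub>free_algebra\<^esub> p"

lemma ideal_A_ideal: "ideal (A_ideal q \<alpha> \<gamma>) free_algebra"
  unfolding A_ideal_def by (rule ring.genideal_ideal[OF ring_free_algebra]) (simp add: free_algebra_def)

lemma A_relations_subset: "A_relations q \<alpha> \<gamma> \<subseteq> A_ideal q \<alpha> \<gamma>"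
  unfolding A_ideal_def by (rule ring.genideal_self[OF ring_free_algebra]) (simp add: free_algebra_def)

lemma A_ideal_subset:
  "\<lbrakk>two_sided_ideal K; A_relations q \<alpha> \<gamma> \<subseteq> K\<rbrakk> \<Longrightarrow> A_ideal q \<alpha> \<gamma> \<subseteq> K"
  unfolding A_ideal_def
  by (rule ring.genideal_minimal[OF ring_free_algebra ideal_free_algebraI])

lemma two_sided_A_ideal: "two_sided_ideal (A_ideal q \<alpha> \<gamma>)"
proof -
  interpret ideal "A_ideal q \<alpha> \<gamma>" free_algebra by (rule ideal_A_ideal)
  have l: "b * a \<in> A_ideal q \<alpha> \<gamma>" and r: "a * b \<in> A_ideal q \<alpha> \<gamma>" if "a \<in> A_ideal q \<alpha> \<gamma>" for a b
    using I_l_closed[OF that, of b] I_r_closed[OF that, of b] by (simp_all add: free_algebra_def)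
  have add: "a + b \<in> A_ideal q \<alpha> \<gamma>" if "a \<in> A_ideal q \<alpha> \<gamma>" "b \<in> A_ideal q \<alpha> \<gamma>" for a b
    using additive_subgroup.a_closed[OF is_additive_subgroup that] by (simp add: free_algebra_def)
  show ?thesis
  proof
    show "0 \<in> A_ideal q \<alpha> \<gamma>"
      using additive_subgroup.zero_closed[OF is_additive_subgroup] by (simp add: free_algebra_def)
    show "a - b \<in> A_ideal q \<alpha> \<gamma>" if "a \<in> A_ideal q \<alpha> \<gamma>" "b \<in> A_ideal q \<alpha> \<gamma>" for a b
      using add[OF that(1) l[OF that(2), of "- 1"]] by simp
  qed (use l r in auto)
qed

lemma ring_A_algebra: "ring (A_algebra q \<alpha> \<gamma>)"
  unfolding A_algebra_def by (rule ideal.quotient_is_ring[OF ideal_A_ideal])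

lemma res_hom: "ring_hom_ring free_algebra (A_algebra q \<alpha> \<gamma>) res"
  using ideal.rcos_ring_hom_ring[OF ideal_A_ideal] unfolding A_algebra_def res_def[abs_def] .

lemma carrier_A_algebra: "carrier (A_algebra q \<alpha> \<gamma>) = range res"
  by (auto simp: A_algebra_def FactRing_def A_RCOSETS_def' res_def free_algebra_def)

lemma res_mem: "res p \<in> carrier (A_algebra q \<alpha> \<gamma>)"
  by (simp add: carrier_A_algebra)

lemma res_add: "res (p + p') = res p \<oplus>\<^bsub>A_algebra q \<alpha> \<gamma>\<^esub> res p'"
  and res_mult: "res (p * p') = res p \<otimes>\<^bsub>A_algebra q \<alpha> \<gamma>\<^esub> res p'"
  and res_1: "res 1 = \<one>\<^bsub>A_algebra q \<alpha> \<gamma>\<^esub>"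
  and res_0: "res 0 = \<zero>\<^bsub>A_algebra q \<alpha> \<gamma>\<^esub>"
proof -
  interpret ring_hom_ring free_algebra "A_algebra q \<alpha> \<gamma>" res by (rule res_hom)
  show "res (p + p') = res p \<oplus>\<^bsub>A_algebra q \<alpha> \<gamma>\<^esub> res p'"
    and "res (p * p') = res p \<otimes>\<^bsub>A_algebra q \<alpha> \<gamma>\<^esub> res p'"
    and "res 1 = \<one>\<^bsub>A_algebra q \<alpha> \<gamma>\<^esub>" and "res 0 = \<zero>\<^bsub>A_algebra q \<alpha> \<gamma>\<^esub>"
    using hom_add[of p p'] hom_mult[of p p'] hom_one hom_zero
    by (simp_all add: free_algebra_def)
qed

lemma A_gen_eq: "A_gen q \<alpha> \<gamma> g = res (fgen g)"
  by (simp add: A_gen_def res_def)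

lemma res_eq_zero: "p \<in> A_ideal q \<alpha> \<gamma> \<Longrightarrow> res p = \<zero>\<^bsub>A_algebra q \<alpha> \<gamma>\<^esub>"
proof -
  interpret ideal "A_ideal q \<alpha> \<gamma>" free_algebra by (rule ideal_A_ideal)
  assume "p \<in> A_ideal q \<alpha> \<gamma>"
  then show ?thesis
    using a_rcos_const by (simp add: res_def A_algebra_def FactRing_def)
qed

lemma res_eq_image: "res p = (\<lambda>i. i + p) ` A_ideal q \<alpha> \<gamma>"
  by (auto simp: res_def a_r_coset_def' free_algebra_def)

end

lemma skew_relations_free_algebra:
  fixes q \<alpha> \<gamma> :: "'k::alg_closed_field"
  assumes "primitive_root_of_unity l (q ^ 2)" "l > 1" "\<gamma> \<noteq> 0"
  shows "skew_relations (A_ideal q \<alpha> \<gamma>) fscal (fgen Gx) (fgen Gy) (fgen Gz) (q ^ 2) \<alpha> \<gamma> l"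
proof -
  interpret two_sided_ideal "A_ideal q \<alpha> \<gamma>" by (rule two_sided_A_ideal)
  show ?thesis
  proof
    fix P :: "(word \<Rightarrow>\<^sub>0 'k) \<Rightarrow> bool" and a
    assume *: "P 1" "\<And>a b. P a \<Longrightarrow> P b \<Longrightarrow> P (a + b)" "\<And>a c. P a \<Longrightarrow> P (a * fscal c)"
      and "\<And>a. P a \<Longrightarrow> P (a * fgen Gx)" "\<And>a. P a \<Longrightarrow> P (a * fgen Gy)"
        "\<And>a. P a \<Longrightarrow> P (a * fgen Gz)"
    then have "P (a * fgen g)" if "P a" for a g
      using that by (cases g) auto
    with * show "P a"
      by (rule free_algebra_induct)
  next
    have "q powi - 2 = inverse (q ^ 2)"
      by (simp add: power_int_minus)
    then show "fgen Gx * fgen Gy - (fscal (q\<^sup>2) * fgen Gy * fgen Gx + fscal \<alpha>) \<in> A_ideal q \<alpha> \<gamma>"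
      and "fgen Gx * fgen Gz - fscal (inverse (q\<^sup>2)) * fgen Gz * fgen Gx \<in> A_ideal q \<alpha> \<gamma>"
      and "fgen Gy * fgen Gz - (fscal (q\<^sup>2) * fgen Gz * fgen Gy + fscal \<gamma>) \<in> A_ideal q \<alpha> \<gamma>"
      using A_relations_subset[of q \<alpha> \<gamma>] by (simp_all add: A_relations_def)
  qed (use assms fscal_central in \<open>simp_all add: fscal_add fscal_mult fscal_1\<close>)
qed

section \<open>Simple modules and annihilators\<close>

context right_module
begin

lemma ract_zero_left: "a \<in> carrier R \<Longrightarrow> \<zero>\<^bsub>M\<^esub> \<triangleleft> a = \<zero>\<^bsub>M\<^esub>"
  using ract_add_left[of "\<zero>\<^bsub>M\<^esub>" "\<zero>\<^bsub>M\<^esub>" a] ract_closed[of "\<zero>\<^bsub>M\<^esub>" a]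
  by (simp add: M.add.l_cancel_one)

lemma ract_zero_right: "m \<in> carrier M \<Longrightarrow> m \<triangleleft> \<zero>\<^bsub>R\<^esub> = \<zero>\<^bsub>M\<^esub>"
  using ract_add_right[of m "\<zero>\<^bsub>R\<^esub>" "\<zero>\<^bsub>R\<^esub>"] ract_closed[of m "\<zero>\<^bsub>R\<^esub>"]
  by (simp add: M.add.l_cancel_one)

lemma ract_minus_right: "\<lbrakk>m \<in> carrier M; a \<in> carrier R\<rbrakk> \<Longrightarrow> m \<triangleleft> (\<ominus>\<^bsub>R\<^esub> a) = \<ominus>\<^bsub>M\<^esub> (m \<triangleleft> a)"
  using ract_add_right[of m "\<ominus>\<^bsub>R\<^esub> a" a] ract_closed ract_zero_right
  by (intro M.minus_equality[symmetric]) (simp_all add: R.l_neg)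

lemma cyclic_submodule:
  assumes m: "m \<in> carrier M"
  shows "right_submodule {m \<triangleleft> a | a. a \<in> carrier R} R M"
  unfolding right_submodule_def
proof (intro conjI ballI)
  show "subgroup {m \<triangleleft> a | a. a \<in> carrier R} (add_monoid M)"
  proof (rule M.add.subgroupI)
    show "\<ominus>\<^bsub>M\<^esub> u \<in> {m \<triangleleft> a | a. a \<in> carrier R}" if "u \<in> {m \<triangleleft> a | a. a \<in> carrier R}" for u
      using that ract_minus_right[OF m, symmetric] by auto
    show "u \<oplus>\<^bsub>M\<^esub> v \<in> {m \<triangleleft> a | a. a \<in> carrier R}"
      if "u \<in> {m \<triangleleft> a | a. a \<in> carrier R}" "v \<in> {m \<triangleleft> a | a. a \<in> carrier R}" for u v
      using that ract_add_right[OF m, symmetric] by auto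
  qed (use m ract_closed R.zero_closed in auto)
  show "u \<triangleleft> b \<in> {m \<triangleleft> a | a. a \<in> carrier R}"
    if "u \<in> {m \<triangleleft> a | a. a \<in> carrier R}" "b \<in> carrier R" for u b
    using that ract_mult[OF m, symmetric] by auto
qed

end

lemma simple_right_module_cyclic:
  assumes "simple_right_module R M" "m \<in> carrier M" "m \<noteq> \<zero>\<^bsub>M\<^esub>"
  shows "carrier M = {m \<triangleleft>\<^bsub>M\<^esub> a | a. a \<in> carrier R}"
proof -
  interpret right_module R M
    using assms(1) unfolding simple_right_module_def by blast
  have "m \<in> {m \<triangleleft>\<^bsub>M\<^esub> a | a. a \<in> carrier R}"
    using ract_one[OF assms(2)] R.one_closed by force
  then show ?thesis
    using cyclic_submodule[OF assms(2)] assms unfolding simple_right_module_def by blast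
qed

text \<open>Both modules are the quotient of \<open>R\<close> by the same annihilator; the
  isomorphism sends \<open>m a\<close> to \<open>n a\<close>.\<close>

lemma cyclic_right_module_isomorphic:
  assumes "right_module R M" and m: "m \<in> carrier M"
    and M: "carrier M = {m \<triangleleft>\<^bsub>M\<^esub> a | a. a \<in> carrier R}"
    and "right_module R N" and n: "n \<in> carrier N"
    and N: "carrier N = {n \<triangleleft>\<^bsub>N\<^esub> a | a. a \<in> carrier R}"
    and ann: "\<And>a. a \<in> carrier R \<Longrightarrow> m \<triangleleft>\<^bsub>M\<^esub> a = \<zero>\<^bsub>M\<^esub> \<longleftrightarrow> n \<triangleleft>\<^bsub>N\<^esub> a = \<zero>\<^bsub>N\<^esub>"
  shows "right_module_isomorphic R M N"
proof -
  interpret M: right_module R M by fact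
  interpret N: right_module R N by fact
  have eq: "m \<triangleleft>\<^bsub>M\<^esub> a = m \<triangleleft>\<^bsub>M\<^esub> b \<longleftrightarrow> n \<triangleleft>\<^bsub>N\<^esub> a = n \<triangleleft>\<^bsub>N\<^esub> b"
    if a: "a \<in> carrier R" and b: "b \<in> carrier R" for a b
  proof -
    have "m \<triangleleft>\<^bsub>M\<^esub> a = m \<triangleleft>\<^bsub>M\<^esub> b \<longleftrightarrow> m \<triangleleft>\<^bsub>M\<^esub> (a \<ominus>\<^bsub>R\<^esub> b) = \<zero>\<^bsub>M\<^esub>"
      using a b m by (simp add: a_minus_def M.ract_add_right M.ract_minus_right M.ract_closed)
        (metis M.M.minus_equality M.M.minus_minus M.M.a_inv_closed M.M.r_neg M.ract_closed)
    also have "\<dots> \<longleftrightarrow> n \<triangleleft>\<^bsub>N\<^esub> (a \<ominus>\<^bsub>R\<^esub> b) = \<zero>\<^bsub>N\<^esub>"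
      by (rule ann) (use a b in simp)
    also have "\<dots> \<longleftrightarrow> n \<triangleleft>\<^bsub>N\<^esub> a = n \<triangleleft>\<^bsub>N\<^esub> b"
      using a b n by (simp add: a_minus_def N.ract_add_right N.ract_minus_right N.ract_closed)
        (metis N.M.minus_equality N.M.minus_minus N.M.a_inv_closed N.M.r_neg N.ract_closed)
    finally show ?thesis .
  qed
  define f where "f u = n \<triangleleft>\<^bsub>N\<^esub> (SOME a. a \<in> carrier R \<and> u = m \<triangleleft>\<^bsub>M\<^esub> a)" for u
  have f: "f (m \<triangleleft>\<^bsub>M\<^esub> a) = n \<triangleleft>\<^bsub>N\<^esub> a" if "a \<in> carrier R" for a
  proof -
    have "\<exists>b. b \<in> carrier R \<and> m \<triangleleft>\<^bsub>M\<^esub> a = m \<triangleleft>\<^bsub>M\<^esub> b"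
      using that by blast
    from someI_ex[OF this] show ?thesis
      unfolding f_def using eq that by metis
  qed
  have "bij_betw f (carrier M) (carrier N)"
    unfolding bij_betw_def M N
  proof
    show "inj_on f {m \<triangleleft>\<^bsub>M\<^esub> a | a. a \<in> carrier R}"
      by (rule inj_onI) (auto simp: f eq)
    show "f ` {m \<triangleleft>\<^bsub>M\<^esub> a | a. a \<in> carrier R} = {n \<triangleleft>\<^bsub>N\<^esub> a | a. a \<in> carrier R}"
      by (force simp: f image_iff)
  qed
  moreover have "f (u \<oplus>\<^bsub>M\<^esub> v) = f u \<oplus>\<^bsub>N\<^esub> f v" if uv: "u \<in> carrier M" "v \<in> carrier M" for u v
  proof -
    obtain a b where "a \<in> carrier R" "b \<in> carrier R" "u = m \<triangleleft>\<^bsub>M\<^esub> a" "v = m \<triangleleft>\<^bsub>M\<^esub> b"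
      using uv unfolding M by blast
    then show ?thesis
      using m n by (simp add: f flip: M.ract_add_right N.ract_add_right)
  qed
  moreover have "f (u \<triangleleft>\<^bsub>M\<^esub> b) = f u \<triangleleft>\<^bsub>N\<^esub> b" if u: "u \<in> carrier M" and b: "b \<in> carrier R" for u b
  proof -
    obtain a where "a \<in> carrier R" "u = m \<triangleleft>\<^bsub>M\<^esub> a"
      using u unfolding M by blast
    then show ?thesis
      using b m n by (simp add: f flip: M.ract_mult N.ract_mult)
  qed
  ultimately show ?thesis
    unfolding right_module_isomorphic_def by blast
qed

context
  fixes q \<alpha> \<gamma> :: "'k::field" and M :: "((word \<Rightarrow>\<^sub>0 'k) set, 'm, 'd) right_module_scheme"
begin

text \<open>Taken in the free algebra, not in its quotient, so that it is a right ideal containing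
  \<open>A_ideal\<close> as \<open>skew_relations\<close> expects.\<close>

definition annihilator :: "'m \<Rightarrow> (word \<Rightarrow>\<^sub>0 'k) set"
  where "annihilator m = {p. m \<triangleleft>\<^bsub>M\<^esub> res q \<alpha> \<gamma> p = \<zero>\<^bsub>M\<^esub>}"

lemma right_ideal_annihilator:
  assumes "right_module (A_algebra q \<alpha> \<gamma>) M" and m: "m \<in> carrier M"
  shows "right_ideal (annihilator m)" and "A_ideal q \<alpha> \<gamma> \<subseteq> annihilator m"
proof -
  interpret right_module "A_algebra q \<alpha> \<gamma>" M by fact
  show "A_ideal q \<alpha> \<gamma> \<subseteq> annihilator m"
    using ract_zero_right[OF m] by (auto simp: annihilator_def res_eq_zero)
  have mult: "a * b \<in> annihilator m" if "a \<in> annihilator m" for a b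
    using that ract_mult[OF m res_mem res_mem, of a b] ract_zero_left[OF res_mem]
    by (simp add: annihilator_def res_mult)
  show "right_ideal (annihilator m)"
  proof
    show "0 \<in> annihilator m"
      using ract_zero_right[OF m] by (simp add: annihilator_def res_0)
    show "a - b \<in> annihilator m" if "a \<in> annihilator m" "b \<in> annihilator m" for a b
      using that(1) mult[OF that(2), of "- 1"] ract_add_right[OF m res_mem res_mem, of a "- b"]
      by (simp add: annihilator_def flip: res_add)
  qed (rule mult)
qed

lemma one_not_in_annihilator:
  assumes "right_module (A_algebra q \<alpha> \<gamma>) M" "m \<in> carrier M" "m \<noteq> \<zero>\<^bsub>M\<^esub>"
  shows "1 \<notin> annihilator m"
  using right_module.ract_one[OF assms(1,2)] assms(3) by (simp add: annihilator_def res_1)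

text \<open>If \<open>m p\<close> is nonzero it generates the simple module, so some
  \<open>a\<close> returns it to \<open>m\<close>.\<close>

lemma annihilator_maximal:
  assumes simple: "simple_right_module (A_algebra q \<alpha> \<gamma>) M" and m: "m \<in> carrier M"
    and p: "p \<notin> annihilator m"
  shows "\<exists>a. p * a - 1 \<in> annihilator m"
proof -
  interpret right_module "A_algebra q \<alpha> \<gamma>" M
    using simple unfolding simple_right_module_def by blast
  have "m \<triangleleft>\<^bsub>M\<^esub> res q \<alpha> \<gamma> p \<in> carrier M" "m \<triangleleft>\<^bsub>M\<^esub> res q \<alpha> \<gamma> p \<noteq> \<zero>\<^bsub>M\<^esub>"
    using p ract_closed[OF m res_mem] by (simp_all add: annihilator_def)
  from simple_right_module_cyclic[OF simple this] m
  obtain a where a: "m = m \<triangleleft>\<^bsub>M\<^esub> res q \<alpha> \<gamma> p \<triangleleft>\<^bsub>M\<^esub> res q \<alpha> \<gamma> a"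
    by (auto simp: carrier_A_algebra)
  have "m \<triangleleft>\<^bsub>M\<^esub> res q \<alpha> \<gamma> (p * a - 1) \<oplus>\<^bsub>M\<^esub> m \<triangleleft>\<^bsub>M\<^esub> res q \<alpha> \<gamma> 1
      = m \<triangleleft>\<^bsub>M\<^esub> res q \<alpha> \<gamma> (p * a)"
    using ract_add_right[OF m res_mem res_mem, of "p * a - 1" 1] by (simp flip: res_add)
  then have "m \<triangleleft>\<^bsub>M\<^esub> res q \<alpha> \<gamma> (p * a - 1) \<oplus>\<^bsub>M\<^esub> m = m"
    using a ract_mult[OF m res_mem res_mem] ract_one[OF m] by (simp add: res_1 res_mult)
  then have "m \<triangleleft>\<^bsub>M\<^esub> res q \<alpha> \<gamma> (p * a - 1) = \<zero>\<^bsub>M\<^esub>"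
    using M.add.r_cancel_one[OF m ract_closed[OF m res_mem]] by simp
  then show ?thesis
    unfolding annihilator_def by blast
qed

end

section \<open>The modules \<open>M\<^sub>5(\<mu>\<^sub>1, \<mu>\<^sub>2)\<close>\<close>

locale M5_parameters =
  fixes q \<alpha> \<gamma> :: "'k::field" and l :: nat and \<mu>1 \<mu>2 :: 'k
  assumes root: "primitive_root_of_unity l (q ^ 2)" and l: "l > 1" and \<gamma>: "\<gamma> \<noteq> 0"
begin

definition t :: 'k where "t = q ^ 2"
abbreviation t' :: 'k where "t' \<equiv> inverse t"
definition V :: "(nat \<Rightarrow> 'k) set" where "V = {v. \<forall>k\<ge>l. v k = 0}"
abbreviation gact :: "(nat \<Rightarrow> 'k) \<Rightarrow> gen \<Rightarrow> (nat \<Rightarrow> 'k)" where "gact \<equiv> M5_gen_act q \<alpha> \<gamma> l \<mu>1 \<mu>2"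
abbreviation act :: "(nat \<Rightarrow> 'k) \<Rightarrow> (word \<Rightarrow>\<^sub>0 'k) \<Rightarrow> (nat \<Rightarrow> 'k)" where "act \<equiv> M5_free_act q \<alpha> \<gamma> l \<mu>1 \<mu>2"

lemma V_D: "\<lbrakk>v \<in> V; k \<ge> l\<rbrakk> \<Longrightarrow> v k = 0"
  by (simp add: V_def)

lemma V_add: "\<lbrakk>v \<in> V; w \<in> V\<rbrakk> \<Longrightarrow> (\<lambda>k. v k + w k) \<in> V"
  by (simp add: V_def)

lemma root_t: "primitive_root_of_unity l t"
  using root by (simp add: t_def)

section \<open>Structure constants of the modules and their recurrences\<close>

definition eigen :: "nat \<Rightarrow> 'k"
  where "eigen k = \<mu>2 * inverse \<gamma> * t' ^ k * (t - 1)"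

definition xlow :: "nat \<Rightarrow> 'k"
  where "xlow k = - t' * \<alpha> * ((1 - t' ^ k) / (1 - t'))"

definition zlow :: "nat \<Rightarrow> 'k"
  where "zlow k = \<gamma> * ((1 - t ^ k) / (1 - t))"

lemma t_nonzero: "t \<noteq> 0"
  using root_t unfolding primitive_root_of_unity_def by (metis power_eq_0_iff zero_neq_one)

lemma t_neq_1: "t \<noteq> 1" and t'_neq_1: "t' \<noteq> 1"
proof -
  show "t \<noteq> 1"
    using root_t l unfolding primitive_root_of_unity_def by (metis power_one_right zero_less_one)
  then show "t' \<noteq> 1"
    by (metis inverse_1 inverse_inverse_eq)
qed

lemma t_power_l: "t ^ l = 1" and t'_power_l: "t' ^ l = 1"
proof -
  show "t ^ l = 1"
    using root_t unfolding primitive_root_of_unity_def by blast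
  then show "t' ^ l = 1"
    by (metis inverse_1 power_inverse)
qed

text \<open>Vanishing at \<open>0\<close> absorbs the case distinction in the action on the basis;
  vanishing at \<open>l\<close> makes lowering compatible with the wrap-around of
  \<open>y\<close>.\<close>

lemma lower_0: "xlow 0 = 0" "zlow 0 = 0" and lower_l: "xlow l = 0" "zlow l = 0"
  by (simp_all only: xlow_def zlow_def t_power_l t'_power_l) simp_all

lemma zlow_nonzero: "\<lbrakk>0 < k; k < l\<rbrakk> \<Longrightarrow> zlow k \<noteq> 0"
  using root_t \<gamma> t_neq_1 unfolding zlow_def primitive_root_of_unity_def by auto

text \<open>The recurrences are the relations read on the basis: \<open>xy = t yx + \<alpha>\<close>
  gives \<open>eigen_Suc\<close> and \<open>xlow_Suc\<close>, \<open>yz = t zy + \<gamma>\<close>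
  gives \<open>zlow_Suc\<close>. \<open>eigen_l\<close> is the wrap-around case.\<close>

lemma eigen_Suc: "t * eigen (Suc k) = eigen k"
  using t_nonzero \<gamma> by (simp add: eigen_def field_simps)

lemma eigen_l: "t * eigen 0 = eigen (l - 1)"
proof -
  have "eigen l = eigen 0"
    by (simp only: eigen_def t'_power_l) simp
  then show ?thesis
    using eigen_Suc[of "l - 1"] l by simp
qed

lemma xlow_Suc: "t * xlow (Suc k) + \<alpha> = xlow k"
proof -
  have "t * xlow (Suc k) = - \<alpha> * ((1 - t' * t' ^ k) / (1 - t'))"
    using t_nonzero by (simp add: xlow_def)
  also have "\<dots> = - \<alpha> * ((1 - t' + t' * (1 - t' ^ k)) / (1 - t'))"
    by (simp add: algebra_simps)
  also have "\<dots> = - \<alpha> * (1 + t' * (1 - t' ^ k) / (1 - t'))"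
    using t'_neq_1 by (simp add: add_divide_distrib)
  finally show ?thesis
    by (simp add: xlow_def algebra_simps)
qed

lemma zlow_Suc: "zlow (Suc k) = t * zlow k + \<gamma>"
proof -
  have "zlow (Suc k) = \<gamma> * ((1 - t + t * (1 - t ^ k)) / (1 - t))"
    by (simp add: zlow_def algebra_simps)
  also have "\<dots> = \<gamma> * (1 + t * (1 - t ^ k) / (1 - t))"
    using t_neq_1 by (simp add: add_divide_distrib)
  finally show ?thesis
    by (simp add: zlow_def algebra_simps)
qed

text \<open>Required by the relation between \<open>x\<close> and \<open>z\<close>. The recurrences
  reduce it to \<open>(t - 1) * zlow k * xlow k + \<gamma> * xlow k + \<alpha> * zlow k = 0\<close>,
  which follows from \<open>t ^ k * t' ^ k = 1\<close>.\<close>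

lemma xlow_zlow: "xlow (Suc k) * zlow k = t' * (zlow (Suc k) * xlow k)"
proof -
  have "xlow (Suc k) = t' * (xlow k - \<alpha>)"
    using xlow_Suc[of k] t_nonzero by (simp add: field_simps)
  moreover have "zlow (Suc k) * xlow k = (xlow k - \<alpha>) * zlow k"
  proof -
    have "t * zlow k * xlow k + \<gamma> * xlow k = xlow k * zlow k - \<alpha> * zlow k"
    proof -
      have a: "xlow k = - \<alpha> * ((1 - t' ^ k) / (t - 1))"
        using t_nonzero t_neq_1 t'_neq_1 by (simp add: xlow_def divide_simps, (simp add: algebra_simps)?)
      have b: "zlow k = \<gamma> * ((t ^ k - 1) / (t - 1))"
        using t_neq_1 by (simp add: zlow_def divide_simps, (simp add: algebra_simps)?)
      define T T' where "T = t ^ k" and "T' = t' ^ k"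
      have TT': "T * T' = 1"
        unfolding T_def T'_def using t_nonzero by (simp flip: power_mult_distrib)
      have "(t - 1) * zlow k * xlow k + \<gamma> * xlow k + \<alpha> * zlow k
          = \<alpha> * \<gamma> / (t - 1) * ((T - 1) - (1 - T') - (T - 1) * (1 - T'))"
        unfolding a b T_def[symmetric] T'_def[symmetric]
        using t_neq_1 by (simp add: divide_simps, (simp add: algebra_simps)?)
      also have "(T - 1) - (1 - T') - (T - 1) * (1 - T') = 0"
        using TT' by (simp add: algebra_simps)
      finally show ?thesis
        by (simp add: algebra_simps)
    qed
    then show ?thesis
      by (simp add: zlow_Suc algebra_simps)
  qed
  ultimately show ?thesis
    by simp
qed

lemma powi_eq: "q powi (- 2 * int k) = t' ^ k" "q powi (-2) = t'"
proof -
  show 2: "q powi (-2) = t'"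
    by (simp add: power_int_minus t_def)
  have "q powi (- 2 * int k) = (q powi (-2)) ^ k"
    by (simp only: power_int_mult power_int_of_nat)
  then show "q powi (- 2 * int k) = t' ^ k"
    by (simp only: 2)
qed

text \<open>Coordinate \<open>j\<close> of the image receives contributions from the basis vectors
  \<open>j\<close> and \<open>j + 1\<close>; on \<open>V\<close> the formula remains valid for
  indices beyond the range.\<close>

lemma gact_x:
  assumes "v \<in> V"
  shows "gact v Gx j = eigen j * v j + xlow (Suc j) * v (Suc j)"
proof -
  have "v k * M5_on_basis q \<alpha> \<gamma> l \<mu>1 \<mu>2 Gx k j
      = (if k = j then eigen j * v j else 0) + (if k = Suc j then xlow (Suc j) * v (Suc j) else 0)" for k
  proof (cases "k = 0")
    case True
    then show ?thesis
      by (auto simp: eigen_def M5_basis_def t_def)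
  next
    case False
    have "M5_on_basis q \<alpha> \<gamma> l \<mu>1 \<mu>2 Gx k j = eigen k * M5_basis k j + xlow k * M5_basis (k - 1) j"
      using False by (simp only: M5_on_basis.simps powi_eq eigen_def xlow_def if_False)
        (simp only: t_def diff_conv_add_uminus mult_minus_left)
    then show ?thesis
      using False by (auto simp: M5_basis_def)
  qed
  then show ?thesis
    using assms by (simp add: M5_gen_act_def sum.distrib V_D del: M5_on_basis.simps)
qed

lemma gact_z:
  assumes "v \<in> V"
  shows "gact v Gz j = zlow (Suc j) * v (Suc j)"
proof -
  have "v k * M5_on_basis q \<alpha> \<gamma> l \<mu>1 \<mu>2 Gz k j
      = (if k = Suc j then zlow (Suc j) * v (Suc j) else 0)" for k
    by (cases "k = 0") (auto simp: zlow_def M5_basis_def power_mult t_def simp del: power_Suc)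
  then show ?thesis
    using assms by (simp add: M5_gen_act_def V_D del: M5_on_basis.simps)
qed

lemma gact_y: "gact v Gy j = (if j = 0 then \<mu>1 * v (l - 1) else if j < l then v (j - 1) else 0)"
proof -
  have "v k * M5_on_basis q \<alpha> \<gamma> l \<mu>1 \<mu>2 Gy k j
      = (if k = l - 1 then (if j = 0 then \<mu>1 * v (l - 1) else 0) else 0)
      + (if k = j - 1 then (if 0 < j \<and> j < l then v (j - 1) else 0) else 0)" if "k < l" for k
    using that by (auto simp: M5_basis_def)
  then show ?thesis
    using l by (auto simp: M5_gen_act_def sum.distrib simp del: M5_on_basis.simps)
qed

lemma gact_closed:
  assumes "v \<in> V"
  shows "gact v g \<in> V"
proof -
  have "gact v g k = 0" if "k \<ge> l" for k
    using l that V_D[OF assms, of k] V_D[OF assms, of "Suc k"] assms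
    by (cases g) (auto simp: gact_x gact_y gact_z)
  then show ?thesis
    by (simp add: V_def)
qed

text \<open>\<open>y\<close> shifts coordinates up except at \<open>Suc j = l\<close>, and exactly
  there the lowering coefficient is zero.\<close>

lemma lower_gact_y:
  assumes "v \<in> V"
  shows "xlow (Suc j) * gact v Gy (Suc j) = xlow (Suc j) * v j"
    and "zlow (Suc j) * gact v Gy (Suc j) = zlow (Suc j) * v j"
  using lower_l V_D[OF assms, of j] by (cases "Suc j = l"; auto simp: gact_y not_less)+

lemma gact_linear: "gact (\<lambda>j. c * v j + d * w j) g = (\<lambda>j. c * gact v g j + d * gact w g j)"
  by (simp add: M5_gen_act_def sum.distrib sum_distrib_left algebra_simps)

lemma foldl_gact_closed: "v \<in> V \<Longrightarrow> foldl gact v gs \<in> V"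
  by (induction gs arbitrary: v) (simp_all only: foldl.simps gact_closed)

lemma foldl_gact_linear:
  "foldl gact (\<lambda>j. c * v j + d * w j) gs = (\<lambda>j. c * foldl gact v gs j + d * foldl gact w gs j)"
  by (induction gs arbitrary: v w) (simp_all add: gact_linear)

section \<open>The action of the free algebra\<close>

lemma act_eq_sum:
  assumes "finite A" "Poly_Mapping.keys p \<subseteq> A"
  shows "act v p j = (\<Sum>w\<in>A. Poly_Mapping.lookup p w * foldl gact v (letters w) j)"
  unfolding M5_free_act_def
  by (rule sum.mono_neutral_left) (use assms in \<open>auto simp: in_keys_iff\<close>)

lemma act_add: "act v (p + p') = (\<lambda>j. act v p j + act v p' j)"
proof
  fix j
  let ?A = "Poly_Mapping.keys p \<union> Poly_Mapping.keys p'"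
  have "act v (p + p') j = (\<Sum>w\<in>?A. Poly_Mapping.lookup (p + p') w * foldl gact v (letters w) j)"
    by (rule act_eq_sum) (simp_all add: keys_add)
  also have "\<dots> = act v p j + act v p' j"
    by (simp add: act_eq_sum[of ?A] lookup_add distrib_right sum.distrib)
  finally show "act v (p + p') j = act v p j + act v p' j" .
qed

lemma act_single: "act v (Poly_Mapping.single w c) = (\<lambda>j. c * foldl gact v (letters w) j)"
  by (rule ext, subst act_eq_sum[of "{w}"]) simp_all

lemma act_linear: "act (\<lambda>j. c * v j + d * w j) p = (\<lambda>j. c * act v p j + d * act w p j)"
  by (simp add: M5_free_act_def foldl_gact_linear sum.distrib sum_distrib_left algebra_simps)

lemma act_closed:
  assumes "v \<in> V"
  shows "act v p \<in> V"
proof -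
  have "foldl gact v gs k = 0" if "k \<ge> l" for gs k
    using foldl_gact_closed[OF assms] that by (rule V_D)
  then show ?thesis
    by (simp add: V_def M5_free_act_def)
qed

lemma act_scale: "act (\<lambda>j. c * v j) p = (\<lambda>j. c * act v p j)"
  using act_linear[of c v 0 v p] by simp

lemma act_add_left: "act (\<lambda>j. v j + w j) p = (\<lambda>j. act v p j + act w p j)"
  using act_linear[of 1 v 1 w p] by simp

lemma act_zero: "act v 0 = (\<lambda>_. 0)" "act (\<lambda>_. 0) p = (\<lambda>_. 0)"
  using act_scale[of 0 v p] by (simp_all add: M5_free_act_def)

lemma act_mult: "act v (p * p') = act (act v p) p'"
proof (induction p arbitrary: v rule: poly_mapping_single_induct)
  case (1 w c)
  show ?case
  proof (induction p' rule: poly_mapping_single_induct)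
    case (1 w' c')
    have "foldl gact (\<lambda>j. c * foldl gact v (letters w) j) (letters w')
        = (\<lambda>j. c * foldl gact (foldl gact v (letters w)) (letters w') j)"
      using foldl_gact_linear[of c "foldl gact v (letters w)" 0 v] by simp
    then show ?case
      by (simp add: mult_single act_single plus_word_def mult.assoc mult.left_commute)
  next
    case (2 a b)
    then show ?case by (simp add: distrib_left act_add)
  qed
next
  case (2 a b)
  then show ?case by (simp add: distrib_right act_add act_add_left)
qed

lemma act_fscal: "act v (fscal c) = (\<lambda>j. c * v j)"
  by (simp add: fscal_def act_single zero_word_def)

lemma act_fgen: "act v (fgen g) = gact v g"
  by (simp add: fgen_def act_single)

lemma act_1: "act v 1 = v"
  using act_fscal[of v 1] by (simp add: fscal_1)

lemma act_uminus: "act v (- p) = (\<lambda>j. - act v p j)"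
  using act_mult[of v p "fscal (- 1)"] act_fscal[of "act v p" "- 1"]
  by (simp add: fscal_def single_uminus fscal_1[unfolded fscal_def])

lemma act_diff: "act v (p - p') = (\<lambda>j. act v p j - act v p' j)"
  using act_add[of v p "- p'"] by (simp add: act_uminus)

lemma relations_act_zero:
  assumes v: "v \<in> V" and p: "p \<in> A_relations q \<alpha> \<gamma>"
  shows "act v p = (\<lambda>_. 0)"
proof -
  note V = gact_closed[OF v]
  have scale: "gact (\<lambda>j. c * v j) g = (\<lambda>j. c * gact v g j)" for c g v
    using gact_linear[of c v 0 v] by simp
  have xy: "gact (gact v Gx) Gy j = t * gact (gact v Gy) Gx j + \<alpha> * v j" for j
  proof -
    have "t * gact (gact v Gy) Gx j + \<alpha> * v j
        = t * eigen j * gact v Gy j + (t * xlow (Suc j) + \<alpha>) * v j"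
      using lower_gact_y(1)[OF v, of j] by (simp add: gact_x V algebra_simps)
    also have "\<dots> = t * eigen j * gact v Gy j + xlow j * v j"
      by (simp only: xlow_Suc)
    also have "\<dots> = gact (gact v Gx) Gy j"
      using l V_D[OF v, of j] V_D[OF v, of l]
      by (cases j) (auto simp: gact_y gact_x[OF v] eigen_l eigen_Suc lower_0)
    finally show ?thesis ..
  qed
  have xz: "gact (gact v Gx) Gz j = t' * gact (gact v Gz) Gx j" for j
  proof -
    have "eigen (Suc j) = t' * eigen j"
      using eigen_Suc[of j] t_nonzero by (simp add: field_simps)
    moreover have "v (Suc (Suc j)) * (xlow (Suc (Suc j)) * zlow (Suc j))
        = v (Suc (Suc j)) * (t' * (zlow (Suc (Suc j)) * xlow (Suc j)))"
      by (simp only: xlow_zlow)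
    ultimately show ?thesis
      by (simp add: gact_x gact_z V v algebra_simps)
  qed
  have yz: "gact (gact v Gy) Gz j = t * gact (gact v Gz) Gy j + \<gamma> * v j" for j
  proof -
    have "gact (gact v Gz) Gy j = zlow j * v j"
      using l V_D[OF v, of j] V_D[OF v, of l] by (cases j) (auto simp: gact_y gact_z[OF v] lower_0)
    then show ?thesis
      using lower_gact_y(2)[OF v, of j] by (simp add: gact_z V zlow_Suc algebra_simps)
  qed
  show ?thesis
    using p by (auto simp: A_relations_def act_diff act_add act_mult act_fscal act_fgen
        scale xy xz yz powi_eq simp flip: t_def)
qed

text \<open>Elements that kill all of \<open>V\<close> form a two-sided ideal, and this ideal
  contains the relations.\<close>

lemma A_ideal_act_zero:
  assumes "v \<in> V" and "p \<in> A_ideal q \<alpha> \<gamma>"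
  shows "act v p = (\<lambda>_. 0)"
proof -
  have "two_sided_ideal {p. \<forall>v\<in>V. act v p = (\<lambda>_. 0)}"
    by unfold_locales (simp_all add: act_zero act_diff act_mult act_closed)
  then have "A_ideal q \<alpha> \<gamma> \<subseteq> {p. \<forall>v\<in>V. act v p = (\<lambda>_. 0)}"
    by (rule A_ideal_subset) (use relations_act_zero in blast)
  then show ?thesis
    using assms by blast
qed

abbreviation M :: "((word \<Rightarrow>\<^sub>0 'k) set, nat \<Rightarrow> 'k) right_module"
  where "M \<equiv> M5 q \<alpha> \<gamma> l \<mu>1 \<mu>2"

lemma carrier_M: "carrier M = V"
  and zero_M: "\<zero>\<^bsub>M\<^esub> = (\<lambda>_. 0)"
  and add_M: "v \<oplus>\<^bsub>M\<^esub> w = (\<lambda>k. v k + w k)"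
  by (simp_all add: M5_def V_def)

text \<open>All representatives of a class act equally, so the image under \<open>the_elem\<close>
  is a singleton.\<close>

lemma ract_M:
  assumes v: "v \<in> V"
  shows "v \<triangleleft>\<^bsub>M\<^esub> res q \<alpha> \<gamma> p = act v p"
proof -
  interpret two_sided_ideal "A_ideal q \<alpha> \<gamma>" by (rule two_sided_A_ideal)
  have "act v ` res q \<alpha> \<gamma> p = {act v p}"
    using zero_mem by (auto simp: res_eq_image act_add A_ideal_act_zero[OF v] image_iff)
  then show ?thesis
    by (simp add: M5_def)
qed

lemma right_module_M: "right_module (A_algebra q \<alpha> \<gamma>) M"
proof -
  have "abelian_group M"
  proof (rule abelian_groupI)
    show "\<exists>w\<in>carrier M. w \<oplus>\<^bsub>M\<^esub> v = \<zero>\<^bsub>M\<^esub>" if "v \<in> carrier M" for v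
      using that by (intro bexI[of _ "\<lambda>k. - v k"]) (simp_all add: carrier_M add_M zero_M V_def)
  qed (auto simp: carrier_M add_M zero_M V_def algebra_simps)
  then show ?thesis
    by (intro right_module.intro right_module_axioms.intro ring_A_algebra)
      (auto simp: carrier_A_algebra carrier_M add_M V_add ract_M act_closed act_add act_add_left
        act_mult act_1 simp flip: res_add res_mult res_1)
qed

abbreviation e :: "nat \<Rightarrow> nat \<Rightarrow> 'k" where "e \<equiv> M5_basis"

lemma basis_mem: "k < l \<Longrightarrow> e k \<in> V"
  by (simp add: M5_basis_def V_def)

lemma basis_nonzero: "e k \<noteq> (\<lambda>_. 0)"
  by (metis M5_basis_def zero_neq_one)

lemma gact_y_basis: "Suc k < l \<Longrightarrow> gact (e k) Gy = e (Suc k)"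
  using l by (auto simp: gact_y M5_basis_def fun_eq_iff)

lemma act_y_power: "k < l \<Longrightarrow> act (e 0) (fgen Gy ^ k) = e k"
  by (induction k)
    (simp_all add: act_1 power_Suc2 act_mult act_fgen gact_y_basis del: power_Suc)

text \<open>Repeated action of \<open>z\<close> lowers a nonzero vector of a submodule to a multiple
  of \<open>e 0\<close>, and powers of \<open>y\<close> carry \<open>e 0\<close> to every basis
  vector.\<close>

lemma simple_M: "simple_right_module (A_algebra q \<alpha> \<gamma>) M"
proof -
  have "N = {\<zero>\<^bsub>M\<^esub>} \<or> N = carrier M" if N: "right_submodule N (A_algebra q \<alpha> \<gamma>) M" for N
  proof (rule disjCI)
    assume nonzero: "N \<noteq> carrier M"
    interpret N: subgroup N "add_monoid M"
      using N unfolding right_submodule_def by blast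
    have sub: "N \<subseteq> V" and zero: "(\<lambda>_. 0) \<in> N"
      using N.subset N.one_closed by (simp_all add: carrier_M zero_M)
    have add: "(\<lambda>k. v k + w k) \<in> N" if "v \<in> N" "w \<in> N" for v w
      using N.m_closed[OF that] by (simp add: add_M)
    have act: "act v p \<in> N" if "v \<in> N" for v p
      using N that sub ract_M[of v p] res_mem[of q \<alpha> \<gamma> p] unfolding right_submodule_def
      by (metis subsetD)
    have scale: "(\<lambda>j. c * v j) \<in> N" if "v \<in> N" for v c
      using act[OF that, of "fscal c"] by (simp add: act_fscal)
    \<comment> \<open>Induction on the top index \<open>d\<close> of the support: \<open>z\<close>
      lowers it by one, with the nonzero factor \<open>zlow d\<close>.\<close>
    have lowest: "e 0 \<in> N" if "v \<in> N" "v d \<noteq> 0" "\<And>k. k > d \<Longrightarrow> v k = 0" for v d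
      using that
    proof (induction d arbitrary: v)
      case 0
      have "(\<lambda>j. inverse (v 0) * v j) = e 0"
        using 0 by (auto simp: M5_basis_def fun_eq_iff)
      then show ?case
        using scale[OF 0(1)] by metis
    next
      case (Suc d)
      have v: "v \<in> V" using Suc.prems(1) sub by blast
      then have "Suc d < l"
        using Suc.prems(2) V_D by (metis not_le)
      show ?case
      proof (rule Suc.IH)
        show "gact v Gz \<in> N"
          using act[OF Suc.prems(1), of "fgen Gz"] by (simp add: act_fgen)
        show "gact v Gz d \<noteq> 0" "\<And>k. k > d \<Longrightarrow> gact v Gz k = 0"
          using \<open>Suc d < l\<close> Suc.prems(2,3) zlow_nonzero[of "Suc d"] by (simp_all add: gact_z[OF v])
      qed
    qed
    have "N = carrier M" if "e 0 \<in> N"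
    proof -
      have basis: "e k \<in> N" if "k < l" for k
        using act[OF \<open>e 0 \<in> N\<close>] act_y_power[OF that] by metis
      have "v \<in> N" if "n \<le> l" "\<And>k. k \<ge> n \<Longrightarrow> v k = 0" for v n
        using that
      proof (induction n arbitrary: v)
        case 0
        then have "v = (\<lambda>_. 0)" by (simp add: fun_eq_iff)
        then show ?case using zero by simp
      next
        case (Suc n)
        have "(\<lambda>k. (v(n := 0)) k + v n * e n k) \<in> N"
          by (intro add scale basis Suc.IH) (use Suc.prems in auto)
        moreover have "(\<lambda>k. (v(n := 0)) k + v n * e n k) = v"
          by (auto simp: M5_basis_def fun_eq_iff)
        ultimately show ?case by simp
      qed
      then show ?thesis
        using sub V_D[of _ l] unfolding carrier_M by (auto simp: V_def)
    qed
    with nonzero have "e 0 \<notin> N" by blast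
    have "v = (\<lambda>_. 0)" if "v \<in> N" for v
    proof (rule ccontr)
      assume "v \<noteq> (\<lambda>_. 0)"
      then obtain k where "v k \<noteq> 0" by blast
      moreover have "\<forall>k. v k \<noteq> 0 \<longrightarrow> k \<le> l"
        using that sub V_D by (metis nle_le subsetD)
      ultimately obtain d where "v d \<noteq> 0" "\<forall>k. v k \<noteq> 0 \<longrightarrow> k \<le> d"
        using Nat.ex_has_greatest_nat[of "\<lambda>k. v k \<noteq> 0" k l] by blast
      then have "e 0 \<in> N"
        using that by (intro lowest[of v d]) auto
      then show False
        using \<open>e 0 \<notin> N\<close> by blast
    qed
    then show "N = {\<zero>\<^bsub>M\<^esub>}"
      using zero unfolding zero_M by blast
  qed
  moreover have "carrier M \<noteq> {\<zero>\<^bsub>M\<^esub>}"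
    using basis_mem[of 0] basis_nonzero[of 0] l by (auto simp: carrier_M zero_M)
  ultimately show ?thesis
    unfolding simple_right_module_def using right_module_M by blast
qed

text \<open>These are the memberships that \<open>right_ideal_eq\<close> asks for, with eigenvalues
  \<open>eigen 0\<close> of \<open>x\<close> and \<open>\<mu>1\<close> of \<open>y ^ l\<close> at
  the lowest basis vector.\<close>

lemma annihilator_lowest:
  "fgen Gz \<in> annihilator q \<alpha> \<gamma> M (e 0)"
  "fgen Gx - fscal (eigen 0) \<in> annihilator q \<alpha> \<gamma> M (e 0)"
  "fgen Gy ^ l - fscal \<mu>1 \<in> annihilator q \<alpha> \<gamma> M (e 0)"
proof -
  have e0: "e 0 \<in> V" using basis_mem l by simp
  have "act (e 0) (fgen Gz) = (\<lambda>_. 0)"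
    by (rule ext, simp only: act_fgen gact_z[OF e0]) (simp add: M5_basis_def)
  moreover have "act (e 0) (fgen Gx - fscal (eigen 0)) = (\<lambda>_. 0)"
    by (rule ext, simp only: act_fgen act_diff act_fscal gact_x[OF e0]) (simp add: M5_basis_def)
  moreover have "act (e 0) (fgen Gy ^ l - fscal \<mu>1) = (\<lambda>_. 0)"
  proof -
    have "fgen Gy ^ l = fgen Gy ^ (l - 1) * (fgen Gy :: word \<Rightarrow>\<^sub>0 'k)"
      using l by (metis One_nat_def Suc_lessD Suc_pred power_Suc2)
    then have "act (e 0) (fgen Gy ^ l) = gact (e (l - 1)) Gy"
      using act_y_power[of "l - 1"] l by (simp add: act_mult act_fgen)
    also have "\<dots> = (\<lambda>j. \<mu>1 * e 0 j)"
      using l by (auto simp: gact_y M5_basis_def fun_eq_iff)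
    finally show ?thesis
      by (simp add: act_diff act_fscal)
  qed
  ultimately show "fgen Gz \<in> annihilator q \<alpha> \<gamma> M (e 0)"
    "fgen Gx - fscal (eigen 0) \<in> annihilator q \<alpha> \<gamma> M (e 0)"
    "fgen Gy ^ l - fscal \<mu>1 \<in> annihilator q \<alpha> \<gamma> M (e 0)"
    by (simp_all add: annihilator_def ract_M[OF e0] zero_M)
qed

end

theorem theorem7p3:
  fixes q \<alpha> \<gamma> :: "'k::alg_closed_field"
    and l :: nat
    and M :: "((word \<Rightarrow>\<^sub>0 'k) set, 'm) right_module"
  assumes "q \<noteq> 0"
    and "primitive_root_of_unity l (q ^ 2)"
    and "l > 1"
    and "\<gamma> \<noteq> 0"
    and "simple_right_module (A_algebra q \<alpha> \<gamma>) M"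
    and "acts_nilpotently (A_algebra q \<alpha> \<gamma>) M (A_gen q \<alpha> \<gamma> Gz)"
  shows "\<exists>\<mu>1 \<mu>2 :: 'k.
    simple_right_module (A_algebra q \<alpha> \<gamma>) (M5 q \<alpha> \<gamma> l \<mu>1 \<mu>2) \<and>
    right_module_isomorphic (A_algebra q \<alpha> \<gamma>) M (M5 q \<alpha> \<gamma> l \<mu>1 \<mu>2)"
proof -
  note simple = assms(5)
  interpret skew_relations "A_ideal q \<alpha> \<gamma>" fscal "fgen Gx" "fgen Gy" "fgen Gz" "q ^ 2" \<alpha> \<gamma> l
    by (rule skew_relations_free_algebra) (fact assms)+
  have module: "right_module (A_algebra q \<alpha> \<gamma>) M"
    using simple unfolding simple_right_module_def by blast
  interpret M: right_module "A_algebra q \<alpha> \<gamma>" M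
    by (rule module)
  let ?z = "A_gen q \<alpha> \<gamma> Gz"
  have z: "?z \<in> carrier (A_algebra q \<alpha> \<gamma>)"
    by (simp add: A_gen_eq res_mem)
  \<comment> \<open>Between the exponents 0 and \<open>N\<close> there is an \<open>n\<close> with
    \<open>m z ^ n\<close> nonzero and \<open>m z ^ (n + 1)\<close> zero.\<close>
  obtain m0 where m0: "m0 \<in> carrier M" "m0 \<noteq> \<zero>\<^bsub>M\<^esub>" "m0 \<triangleleft>\<^bsub>M\<^esub> ?z = \<zero>\<^bsub>M\<^esub>"
  proof -
    obtain m where m: "m \<in> carrier M" "m \<noteq> \<zero>\<^bsub>M\<^esub>"
      using simple M.M.zero_closed unfolding simple_right_module_def by blast
    let ?P = "\<lambda>n::nat. m \<triangleleft>\<^bsub>M\<^esub> (?z [^]\<^bsub>A_algebra q \<alpha> \<gamma>\<^esub> n) = \<zero>\<^bsub>M\<^esub>"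
    obtain N where "?P N"
      using assms(6) m unfolding acts_nilpotently_def by blast
    moreover have "\<not> ?P 0"
      using m M.ract_one by simp
    ultimately obtain n where "\<not> ?P n" "?P (Suc n)"
      using nat_induct[of "\<lambda>n. \<not> ?P n" N] by blast
    then show ?thesis
      using m z that[of "m \<triangleleft>\<^bsub>M\<^esub> (?z [^]\<^bsub>A_algebra q \<alpha> \<gamma>\<^esub> n)"]
      by (simp add: M.ract_closed M.ract_mult)
  qed
  define J where "J = annihilator q \<alpha> \<gamma> M m0"
  note J = right_ideal_annihilator[OF module m0(1), folded J_def]
  have J_proper: "1 \<notin> J"
    unfolding J_def by (rule one_not_in_annihilator[OF module m0(1,2)])
  have J_maximal: "\<exists>a. p * a - 1 \<in> J" if "p \<notin> J" for p
    using annihilator_maximal[OF simple m0(1)] that unfolding J_def .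
  have J_z: "fgen Gz \<in> J"
    using m0(3) by (simp add: J_def annihilator_def A_gen_eq)
  obtain a b where ab: "fgen Gx - fscal a \<in> J" "fgen Gy ^ l - fscal b \<in> J"
    using maximal_right_ideal_eigenvalues[OF J J_proper J_maximal J_z] by blast
  \<comment> \<open>Solves \<open>eigen 0 = a\<close>; the other parameter is \<open>b\<close>
    itself.\<close>
  define \<mu>2 where "\<mu>2 = a * \<gamma> / (q ^ 2 - 1)"
  interpret M5: M5_parameters q \<alpha> \<gamma> l b \<mu>2
    by unfold_locales (fact assms)+
  have a: "M5.eigen 0 = a"
  proof -
    have "M5.eigen 0 = \<mu>2 * inverse \<gamma> * (q ^ 2 - 1)"
      by (simp add: M5.eigen_def M5.t_def)
    also have "\<dots> = a"
      using \<open>\<gamma> \<noteq> 0\<close> M5.t_neq_1 by (simp add: M5.t_def \<mu>2_def)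
    finally show ?thesis .
  qed
  define J5 where "J5 = annihilator q \<alpha> \<gamma> (M5 q \<alpha> \<gamma> l b \<mu>2) (M5_basis 0)"
  have e0: "M5_basis 0 \<in> carrier (M5 q \<alpha> \<gamma> l b \<mu>2)" "M5_basis 0 \<noteq> \<zero>\<^bsub>M5 q \<alpha> \<gamma> l b \<mu>2\<^esub>"
    using M5.basis_mem[of 0] M5.basis_nonzero[of 0] \<open>l > 1\<close>
    by (simp_all add: M5.carrier_M M5.zero_M)
  \<comment> \<open>Both annihilators are proper and contain the same three elements, so the two
    cyclic modules can be identified.\<close>
  have "J = J5"
    using right_ideal_annihilator[OF M5.right_module_M e0(1)]
      one_not_in_annihilator[OF M5.right_module_M e0] M5.annihilator_lowest
    unfolding a by (intro right_ideal_eq[OF J J_z ab J_proper]) (simp_all add: J5_def)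
  then have "m0 \<triangleleft>\<^bsub>M\<^esub> c = \<zero>\<^bsub>M\<^esub>
      \<longleftrightarrow> M5_basis 0 \<triangleleft>\<^bsub>M5 q \<alpha> \<gamma> l b \<mu>2\<^esub> c = \<zero>\<^bsub>M5 q \<alpha> \<gamma> l b \<mu>2\<^esub>"
    if "c \<in> carrier (A_algebra q \<alpha> \<gamma>)" for c
    using that unfolding J_def J5_def annihilator_def carrier_A_algebra by blast
  then have "right_module_isomorphic (A_algebra q \<alpha> \<gamma>) M (M5 q \<alpha> \<gamma> l b \<mu>2)"
    by (rule cyclic_right_module_isomorphic[OF module m0(1) simple_right_module_cyclic[OF simple m0(1,2)]
        M5.right_module_M e0(1) simple_right_module_cyclic[OF M5.simple_M e0]])
  then show ?thesis
    using M5.simple_M by blast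
qed

end
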